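(* Let $\alpha>0$ be a fixed constant and let $\beta,\gamma\in\mathbb R$. Let $G=(V,E)$ be a random 3-regular graph on $n$ vertices. Then with high probability on $G$, for every 2-independent set $V_0$ of $G$ with $|V_0|\ge\alpha n$, the expected improvement (increase in the number of satisfied edges) produced by the depth-$1$ local update algorithm with vertex set $V_0$, applied to a cut sampled from the $p=1$ QAOA on $G$ with parameters $\beta,\gamma$, is $$\frac34\left(1+2\sin(2\beta)\cos^2\gamma\,\sin\gamma+\sin^2\beta\,\cos^4\gamma\,\sin^2\gamma\right)|V_0|+o(n).$$
   Context: "With high probability" means with probability tending to $1$ as $n\to\infty$. A set $V_0$ is 2-independent if any two distinct vertices of it are at distance at least $3$. A cut is an assignment $(\sigma_v)_{v\in V}\in\{-1,1\}^V$; an edge $\{u,v\}$ is satisfied if $\sigma_u\ne\sigma_v$. Depth-1 local update algorithm with vertex set $V_0$: given a cut $(\sigma_v)_{v\in V}$, for every $v_0\in V_0$ replace $\sigma_{v_0}$ by the value in $\{-1,1\}$ maximizing the number of satisfied edges incident to $v_0$ given the values $\sigma_w$ of its neighbours $w$ (i.e. the minority value of its three neighbours); all other vertices keep their values. The $p=1$ QAOA state is $$|\psi_G\rangle=\exp\Big(-\tfrac{i\beta}{2}\sum_{v\in V}X_v\Big)\exp\Big(-\tfrac{i\gamma}{2}\sum_{\{e_0,e_1\}\in E}Z_{e_0}Z_{e_1}\Big)|+\rangle^{\otimes n},$$ and a cut is sampled by measuring it in the computational basis, the $Z_v$ eigenvalue giving $\sigma_v$. The expectation is over this measurement. *)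

theory Defs
  imports "HOL-Probability.Probability" "HOL-Library.Landau_Symbols"
    "HOL-Library.Extended_Nat"
begin

section \<open>Random regular graphs\<close>

text \<open>
  A graph with vertex set \<open>{..<n}\<close> is given by its set of edges, each edge being a
  two-element set of vertices.
\<close>

definition regular_graphs :: "nat \<Rightarrow> nat \<Rightarrow> nat set set set" where
  "regular_graphs d n = {E. (\<forall>e\<in>E. e \<subseteq> {..<n} \<and> card e = 2) \<and>
                            (\<forall>v<n. card {e \<in> E. v \<in> e} = d)}"

text \<open>
  \<open>pmf_of_set\<close> is meaningful only on nonempty finite sets; for \<open>d = 3\<close> this means that
  \<open>n\<close> is even and at least 4 (or \<open>n = 0\<close>).
\<close>

definition random_regular_graph :: "nat \<Rightarrow> nat \<Rightarrow> nat set set pmf" where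
  "random_regular_graph d n = pmf_of_set (regular_graphs d n)"

text \<open>The length of a shortest walk, with value \<open>\<infinity>\<close> if there is none.\<close>

definition graph_dist :: "'a set set \<Rightarrow> 'a \<Rightarrow> 'a \<Rightarrow> enat" where
  "graph_dist E u v = Inf {enat k | k. (u, v) \<in> {(x, y). {x, y} \<in> E} ^^ k}"

definition two_independent :: "'a set set \<Rightarrow> 'a set \<Rightarrow> bool" where
  "two_independent E V0 \<longleftrightarrow> (\<forall>u\<in>V0. \<forall>v\<in>V0. u \<noteq> v \<longrightarrow> 3 \<le> graph_dist E u v)"

section \<open>Cuts and the local update algorithm\<close>

text \<open>Cuts are extensional, so that there are exactly \<open>2 ^ card V\<close> of them.\<close>

definition cuts :: "'a set \<Rightarrow> ('a \<Rightarrow> int) set" where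
  "cuts V = V \<rightarrow>\<^sub>E {-1, 1}"

definition satisfied :: "('a \<Rightarrow> int) \<Rightarrow> 'a set \<Rightarrow> bool" where
  "satisfied \<sigma> e \<longleftrightarrow> (\<exists>u v. e = {u, v} \<and> \<sigma> u \<noteq> \<sigma> v)"

definition cut_size :: "'a set set \<Rightarrow> ('a \<Rightarrow> int) \<Rightarrow> nat" where
  "cut_size E \<sigma> = card {e \<in> E. satisfied \<sigma> e}"

text \<open>
  If \<open>v\<close> has odd degree, as in a 3-regular graph, then the two candidate values are never tied.
  All vertices are updated with respect to the original cut; for a 2-independent set this is the
  same as updating them one after the other, in any order.
\<close>

definition local_update :: "'a set set \<Rightarrow> 'a set \<Rightarrow> ('a \<Rightarrow> int) \<Rightarrow> 'a \<Rightarrow> int" where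
  "local_update E V0 \<sigma> = (\<lambda>v. if v \<in> V0
     then arg_max (\<lambda>s. card {e \<in> E. v \<in> e \<and> satisfied (\<sigma>(v := s)) e}) (\<lambda>s. s \<in> {-1, 1})
     else \<sigma> v)"

definition improvement :: "'a set set \<Rightarrow> 'a set \<Rightarrow> ('a \<Rightarrow> int) \<Rightarrow> real" where
  "improvement E V0 \<sigma> = real (cut_size E (local_update E V0 \<sigma>)) - real (cut_size E \<sigma>)"

section \<open>The QAOA state\<close>

text \<open>
  The computational basis of the qubits indexed by \<open>V\<close> is labelled by \<open>cuts V\<close>, the label of a
  basis vector recording its \<open>Z\<close> eigenvalues. A state is the function of its amplitudes; only
  its values on \<open>cuts V\<close> are relevant, and all operators below respect this.
\<close>

type_synonym 'a state = "('a \<Rightarrow> int) \<Rightarrow> complex"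

definition pauli_X :: "'a \<Rightarrow> 'a state \<Rightarrow> 'a state" where
  "pauli_X v \<psi> = (\<lambda>\<sigma>. \<psi> (\<sigma>(v := - \<sigma> v)))"

definition pauli_Z :: "'a \<Rightarrow> 'a state \<Rightarrow> 'a state" where
  "pauli_Z v \<psi> = (\<lambda>\<sigma>. of_int (\<sigma> v) * \<psi> \<sigma>)"

text \<open>The two endpoints of an edge \<open>e\<close> are \<open>Min e\<close> and \<open>Max e\<close>; the order is immaterial.\<close>

definition pauli_ZZ :: "'a :: linorder set \<Rightarrow> 'a state \<Rightarrow> 'a state" where
  "pauli_ZZ e \<psi> = pauli_Z (Min e) (pauli_Z (Max e) \<psi>)"

lemma pauli_ZZ_edge: "pauli_ZZ {u, v} \<psi> = pauli_Z u (pauli_Z v \<psi>)"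
  by (auto simp: pauli_ZZ_def pauli_Z_def min_def max_def)

text \<open>
  The operator exponential, as a power series. As long as finitely many amplitudes are involved,
  pointwise convergence is the same as convergence in norm.
\<close>

definition op_exp :: "('a state \<Rightarrow> 'a state) \<Rightarrow> 'a state \<Rightarrow> 'a state" where
  "op_exp A \<psi> = (\<lambda>\<sigma>. \<Sum>k. (A ^^ k) \<psi> \<sigma> / fact k)"

definition plus_state :: "'a set \<Rightarrow> 'a state" where
  "plus_state V = (\<lambda>\<sigma>. of_real (1 / sqrt (2 ^ card V)))"

definition qaoa_state :: "'a :: linorder set \<Rightarrow> 'a set set \<Rightarrow> real \<Rightarrow> real \<Rightarrow> 'a state" where
  "qaoa_state V E \<beta> \<gamma> =
     op_exp (\<lambda>\<psi> \<sigma>. - (\<i> * of_real \<beta> / 2) * (\<Sum>v\<in>V. pauli_X v \<psi> \<sigma>))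
       (op_exp (\<lambda>\<psi> \<sigma>. - (\<i> * of_real \<gamma> / 2) * (\<Sum>e\<in>E. pauli_ZZ e \<psi> \<sigma>))
         (plus_state V))"

text \<open>Born rule: measuring in the computational basis yields \<open>\<sigma>\<close> with probability
  \<open>(cmod (\<psi> \<sigma>))\<^sup>2\<close>.\<close>

definition measurement_expectation :: "'a set \<Rightarrow> 'a state \<Rightarrow> (('a \<Rightarrow> int) \<Rightarrow> real) \<Rightarrow> real" where
  "measurement_expectation V \<psi> f = (\<Sum>\<sigma>\<in>cuts V. (cmod (\<psi> \<sigma>))\<^sup>2 * f \<sigma>)"

definition expected_improvement ::
    "'a :: linorder set \<Rightarrow> 'a set set \<Rightarrow> real \<Rightarrow> real \<Rightarrow> 'a set \<Rightarrow> real" where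
  "expected_improvement V E \<beta> \<gamma> V0 =
     measurement_expectation V (qaoa_state V E \<beta> \<gamma>) (improvement E V0)"

end

theory Submission
  imports Defs "HOL-Real_Asymp.Real_Asymp"
begin

text \<open>
  At a vertex \<open>v\<close> with neighbours \<open>a, b, c\<close> the update gains
  \<open>max 0 (Z\<^sub>v (Z\<^sub>a + Z\<^sub>b + Z\<^sub>c)) =
    3/4 + (Z\<^sub>v Z\<^sub>a + Z\<^sub>v Z\<^sub>b + Z\<^sub>v Z\<^sub>c) / 2 + (Z\<^sub>a Z\<^sub>b + Z\<^sub>a Z\<^sub>c + Z\<^sub>b Z\<^sub>c) / 4\<close>,
  and the gains at the vertices of an independent set add up. If \<open>v\<close> lies on no triangle and no
  4-cycle, the two-point correlations are those of a tree, namely \<open>sin (2 \<beta>) cos\<^sup>2 \<gamma> sin \<gamma>\<close> at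
  distance one and \<open>sin\<^sup>2 \<beta> cos\<^sup>4 \<gamma> sin\<^sup>2 \<gamma>\<close> at distance two; this gives the main term exactly. Every
  other vertex contributes an error of at most 6. A switching argument bounds the expected number
  of triangles and 4-cycles by a constant, so by Markov's inequality there are at most
  \<open>sqrt n\<close> of them with high probability.
\<close>

section \<open>The QAOA state in the Heisenberg picture\<close>

text \<open>\<open>op_exp\<close> is a pointwise power series, so both exponentials are evaluated by
  diagonalisation: the phase operator is diagonal already, and the mixing operator becomes a product
  of commuting one-qubit rotations. At depth one, the correlation of two vertices \<open>a\<close>
  and \<open>b\<close> then involves only the edges at \<open>a\<close> and at \<open>b\<close>.
  This locality explains why only cycles of length 3 and 4 matter: a pair at distance one is
  disturbed by a common neighbour, a pair of neighbours of \<open>v\<close> by an edge between them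
  or by a second common neighbour, and longer cycles are invisible. The error is bounded by the
  number of short cycles of the graph, a quantity that does not mention \<open>V0\<close>. One event
  on graphs therefore serves all sets \<open>V0\<close> at once, without a union bound over
  exponentially many sets. The random graph is uniform on simple graphs, and switchings act on these
  directly, so the expected number of short cycles comes from a double count.\<close>

text \<open>\<open>rot \<theta> v\<close> is the one-qubit rotation \<open>exp (- \<i> \<theta> X\<^sub>v)\<close>.\<close>

definition rot :: "real \<Rightarrow> 'a \<Rightarrow> 'a state \<Rightarrow> 'a state" where
  "rot \<theta> v \<psi> = (\<lambda>\<sigma>. of_real (cos \<theta>) * \<psi> \<sigma> - \<i> * of_real (sin \<theta>) * pauli_X v \<psi> \<sigma>)"

lemma pauli_X_commute: "pauli_X v (pauli_X w \<psi>) = pauli_X w (pauli_X v \<psi>)"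
  by (cases "v = w") (auto simp: pauli_X_def fun_upd_twist)

lemma pauli_X_involution [simp]: "pauli_X v (pauli_X v \<psi>) = \<psi>"
  by (simp add: pauli_X_def)

lemma pauli_X_linear: "pauli_X v (\<lambda>\<sigma>. a * \<phi> \<sigma> + b * \<psi> \<sigma>) = (\<lambda>\<sigma>. a * pauli_X v \<phi> \<sigma> + b * pauli_X v \<psi> \<sigma>)"
  by (simp add: pauli_X_def)

lemma rot_linear: "rot \<theta> v (\<lambda>\<sigma>. a * \<phi> \<sigma> + b * \<psi> \<sigma>) = (\<lambda>\<sigma>. a * rot \<theta> v \<phi> \<sigma> + b * rot \<theta> v \<psi> \<sigma>)"
  by (simp add: rot_def pauli_X_linear algebra_simps)

lemma rot_commute: "rot \<theta> v (rot \<eta> w \<psi>) = rot \<eta> w (rot \<theta> v \<psi>)"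
  using fun_cong[OF pauli_X_commute[of v w \<psi>]]
  by (simp add: fun_eq_iff rot_def pauli_X_def algebra_simps)

lemma rot_rot: "rot \<theta> v (rot \<eta> v \<psi>) = rot (\<theta> + \<eta>) v \<psi>"
  by (simp add: fun_eq_iff rot_def pauli_X_def cos_add sin_add algebra_simps)

lemma rot_zero [simp]: "rot 0 v \<psi> = \<psi>"
  by (simp add: rot_def)

interpretation rot: comp_fun_commute "rot \<theta>"
  by standard (rule ext, simp only: o_apply, rule rot_commute)

section \<open>The mixing exponential as a product of rotations\<close>

abbreviation mixer :: "real \<Rightarrow> 'a set \<Rightarrow> 'a state \<Rightarrow> 'a state" where
  "mixer \<theta> V \<psi> \<equiv> Finite_Set.fold (rot \<theta>) \<psi> V"

lemma mixer_linear:
  assumes "finite V"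
  shows "mixer \<theta> V (\<lambda>\<sigma>. a * \<phi> \<sigma> + b * \<psi> \<sigma>) = (\<lambda>\<sigma>. a * mixer \<theta> V \<phi> \<sigma> + b * mixer \<theta> V \<psi> \<sigma>)"
  using assms by (induction V) (simp_all add: rot_linear)

text \<open>On a joint eigenvector of the \<open>X\<^sub>v\<close> the exponential series is scalar; splitting off the
  \<open>\<plusminus>1\<close> eigenparts of one \<open>X\<^sub>v\<close> after the other writes every state as a sum of such vectors.\<close>

lemma op_exp_mixer:
  fixes \<beta> :: real
  assumes "finite V"
  shows "op_exp (\<lambda>\<psi> \<sigma>. - (\<i> * of_real \<beta> / 2) * (\<Sum>v\<in>V. pauli_X v \<psi> \<sigma>)) \<psi> = mixer (\<beta> / 2) V \<psi>"
proof -
  define h :: complex where "h = - (\<i> * of_real \<beta> / 2)"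
  define A :: "'a state \<Rightarrow> 'a state" where "A = (\<lambda>\<psi> \<sigma>. h * (\<Sum>v\<in>V. pauli_X v \<psi> \<sigma>))"
  have A_linear: "A (\<lambda>\<sigma>. a * \<phi> \<sigma> + b * \<psi> \<sigma>) = (\<lambda>\<sigma>. a * A \<phi> \<sigma> + b * A \<psi> \<sigma>)" for a b \<phi> \<psi>
    by (simp add: A_def pauli_X_linear fun_eq_iff sum.distrib sum_distrib_left algebra_simps)
  have Ak_linear: "(A ^^ k) (\<lambda>\<sigma>. a * \<phi> \<sigma> + b * \<psi> \<sigma>) = (\<lambda>\<sigma>. a * (A ^^ k) \<phi> \<sigma> + b * (A ^^ k) \<psi> \<sigma>)"
    for a b \<phi> \<psi> k
    by (induction k) (simp_all add: A_linear)
  have eigen: "(\<lambda>k. (A ^^ k) \<psi> \<sigma> / fact k) sums mixer (\<beta> / 2) V \<psi> \<sigma>"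
    if "\<And>w. w \<in> V \<Longrightarrow> pauli_X w \<psi> = (\<lambda>\<sigma>. of_int (\<epsilon> w) * \<psi> \<sigma>)"
      and \<epsilon>: "\<And>w. w \<in> V \<Longrightarrow> \<epsilon> w = 1 \<or> \<epsilon> w = (-1 :: int)" for \<psi> \<sigma> \<epsilon>
  proof -
    define l where "l w = h * of_int (\<epsilon> w)" for w
    have X: "pauli_X w (\<lambda>\<sigma>. c * \<psi> \<sigma>) = (\<lambda>\<sigma>. c * of_int (\<epsilon> w) * \<psi> \<sigma>)" if "w \<in> V" for w c
      using pauli_X_linear[of w c \<psi> 0 \<psi>] \<open>\<And>w. w \<in> V \<Longrightarrow> pauli_X w \<psi> = _\<close>[OF that] by (simp add: mult.assoc)
    have A1: "A (\<lambda>\<sigma>. c * \<psi> \<sigma>) = (\<lambda>\<sigma>. (c * (\<Sum>w\<in>V. l w)) * \<psi> \<sigma>)" for c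
    proof
      fix \<sigma>
      have "A (\<lambda>\<sigma>. c * \<psi> \<sigma>) \<sigma> = h * (\<Sum>w\<in>V. c * of_int (\<epsilon> w) * \<psi> \<sigma>)"
        unfolding A_def by (intro arg_cong2[where f = "(*)"] sum.cong refl) (simp only: X)
      thus "A (\<lambda>\<sigma>. c * \<psi> \<sigma>) \<sigma> = (c * (\<Sum>w\<in>V. l w)) * \<psi> \<sigma>"
        by (simp add: l_def sum_distrib_left sum_distrib_right mult_ac)
    qed
    have Ak: "(A ^^ k) \<psi> = (\<lambda>\<sigma>. (\<Sum>w\<in>V. l w) ^ k * \<psi> \<sigma>)" for k
      by (induction k) (simp_all add: A1 power_commutes)
    have U: "rot (\<beta> / 2) w (\<lambda>\<sigma>. c * \<psi> \<sigma>) = (\<lambda>\<sigma>. (c * exp (l w)) * \<psi> \<sigma>)" if "w \<in> V" for w c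
    proof -
      have "exp (l w) = of_real (cos (\<beta> / 2)) - \<i> * of_real (sin (\<beta> / 2)) * of_int (\<epsilon> w)"
      proof -
        have "l w = \<i> * of_real (- (\<beta> / 2) * of_int (\<epsilon> w))"
          by (simp add: l_def h_def)
        hence "exp (l w) = cis (- (\<beta> / 2) * of_int (\<epsilon> w))"
          by (simp only: cis_conv_exp)
        thus ?thesis using \<epsilon>[OF that] by (auto simp: complex_eq_iff)
      qed
      thus ?thesis unfolding rot_def X[OF that] by (simp only:) (simp add: fun_eq_iff algebra_simps)
    qed
    have M: "mixer (\<beta> / 2) W \<psi> = (\<lambda>\<sigma>. (\<Prod>w\<in>W. exp (l w)) * \<psi> \<sigma>)" if "W \<subseteq> V" for W
      using finite_subset[OF that assms] that
      by (induction W) (simp_all add: U, simp only: mult.commute)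
    have "(\<lambda>k. (\<Sum>w\<in>V. l w) ^ k /\<^sub>R fact k) sums exp (\<Sum>w\<in>V. l w)"
      by (rule exp_converges)
    hence "(\<lambda>k. (\<Sum>w\<in>V. l w) ^ k /\<^sub>R fact k * \<psi> \<sigma>) sums (exp (\<Sum>w\<in>V. l w) * \<psi> \<sigma>)"
      by (rule sums_mult2)
    moreover have "(A ^^ k) \<psi> \<sigma> / fact k = (\<Sum>w\<in>V. l w) ^ k /\<^sub>R fact k * \<psi> \<sigma>" for k
      unfolding Ak by (simp add: scaleR_conv_of_real field_simps)
    ultimately show ?thesis
      unfolding M[OF order_refl] exp_sum[OF assms] by simp
  qed
  \<comment> \<open>\<open>W\<close> holds the qubits whose \<open>X\<close> need not yet be
    diagonal on \<open>\<psi>\<close>. The induction removes them one by one, and for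
    \<open>W = V\<close> nothing is required of \<open>\<psi>\<close>.\<close>
  have "(\<lambda>k. (A ^^ k) \<psi> \<sigma> / fact k) sums mixer (\<beta> / 2) V \<psi> \<sigma>"
    if "W \<subseteq> V"
      and "\<And>w. w \<in> V - W \<Longrightarrow> pauli_X w \<psi> = (\<lambda>\<sigma>. of_int (\<epsilon> w) * \<psi> \<sigma>)"
      and "\<And>w. w \<in> V - W \<Longrightarrow> \<epsilon> w = 1 \<or> \<epsilon> w = (-1 :: int)" for \<psi> \<sigma> \<epsilon> W
    using finite_subset[OF that(1) assms] that
  proof (induction W arbitrary: \<psi> \<epsilon>)
    case empty
    then show ?case using eigen[of \<psi> \<epsilon>] by simp
  next
    case (insert x W)
    \<comment> \<open>The projection \<open>(1 + s X_x) / 2\<close> onto the eigenvalue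
      \<open>s\<close> of \<open>X_x\<close>. It commutes with every other \<open>X_w\<close>, so
      eigenvalues fixed earlier survive.\<close>
    define \<psi>' where "\<psi>' s = (\<lambda>\<sigma>. 1 / 2 * \<psi> \<sigma> + of_int s / 2 * pauli_X x \<psi> \<sigma>)" for s :: int
    have *: "(\<lambda>k. (A ^^ k) (\<psi>' s) \<sigma> / fact k) sums mixer (\<beta> / 2) V (\<psi>' s) \<sigma>"
      if s: "s = 1 \<or> s = -1" for s
    proof (rule insert.IH[of _ "\<epsilon>(x := s)"])
      show "W \<subseteq> V" using insert.prems by simp
    next
      fix w assume w: "w \<in> V - W"
      show "(\<epsilon>(x := s)) w = 1 \<or> (\<epsilon>(x := s)) w = -1"
        using insert.prems(3)[of w] w s by auto
      show "pauli_X w (\<psi>' s) = (\<lambda>\<sigma>. of_int ((\<epsilon>(x := s)) w) * \<psi>' s \<sigma>)"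
      proof (cases "w = x")
        case True
        then show ?thesis using s
          unfolding \<psi>'_def pauli_X_linear by (auto simp: fun_eq_iff)
      next
        case False
        have "pauli_X w (pauli_X x \<psi>) = (\<lambda>\<sigma>. of_int (\<epsilon> w) * pauli_X x \<psi> \<sigma>)"
          using insert.prems(2)[of w] w False pauli_X_linear[of x "of_int (\<epsilon> w)" \<psi> 0 \<psi>]
          by (simp add: pauli_X_commute[of w x])
        then show ?thesis using insert.prems(2)[of w] w False
          unfolding \<psi>'_def pauli_X_linear by (simp add: fun_eq_iff algebra_simps)
      qed
    qed
    have \<psi>: "\<psi> = (\<lambda>\<sigma>. 1 * \<psi>' 1 \<sigma> + 1 * \<psi>' (-1) \<sigma>)"
      by (simp add: \<psi>'_def)
    have "(\<lambda>k. (A ^^ k) (\<psi>' 1) \<sigma> / fact k + (A ^^ k) (\<psi>' (-1)) \<sigma> / fact k)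
        sums (mixer (\<beta> / 2) V (\<psi>' 1) \<sigma> + mixer (\<beta> / 2) V (\<psi>' (-1)) \<sigma>)"
      by (intro sums_add *) auto
    moreover have "(A ^^ k) \<psi> \<sigma> / fact k = (A ^^ k) (\<psi>' 1) \<sigma> / fact k + (A ^^ k) (\<psi>' (-1)) \<sigma> / fact k" for k
      by (subst \<psi>, subst Ak_linear) (simp add: add_divide_distrib)
    moreover have "mixer (\<beta> / 2) V \<psi> \<sigma> = mixer (\<beta> / 2) V (\<psi>' 1) \<sigma> + mixer (\<beta> / 2) V (\<psi>' (-1)) \<sigma>"
      by (subst \<psi>, subst mixer_linear[OF assms]) simp
    ultimately show ?case by simp
  qed
  from this[of V] have "(\<lambda>k. (A ^^ k) \<psi> \<sigma> / fact k) sums mixer (\<beta> / 2) V \<psi> \<sigma>" for \<sigma>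
    by auto
  thus ?thesis
    unfolding op_exp_def h_def[symmetric] A_def[symmetric] by (auto simp: fun_eq_iff sums_iff)
qed

section \<open>The phase exponential and the closed form of the state\<close>

definition energy :: "'a::linorder set set \<Rightarrow> ('a \<Rightarrow> int) \<Rightarrow> int" where
  "energy E \<sigma> = (\<Sum>e\<in>E. \<sigma> (Min e) * \<sigma> (Max e))"

definition phase_state :: "'a::linorder set \<Rightarrow> 'a set set \<Rightarrow> real \<Rightarrow> 'a state" where
  "phase_state V E \<gamma> = (\<lambda>\<sigma>. of_real (1 / sqrt (2 ^ card V)) * cis (- (\<gamma> / 2) * of_int (energy E \<sigma>)))"

lemma op_exp_diagonal: "op_exp (\<lambda>\<psi> \<sigma>. d \<sigma> * \<psi> \<sigma>) \<psi> = (\<lambda>\<sigma>. exp (d \<sigma>) * \<psi> \<sigma>)"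
proof
  fix \<sigma>
  have pow: "((\<lambda>\<psi> \<sigma>. d \<sigma> * \<psi> \<sigma>) ^^ k) \<psi> = (\<lambda>\<sigma>. d \<sigma> ^ k * \<psi> \<sigma>)" for k
    by (induction k) (simp_all add: mult.assoc)
  have "(\<lambda>k. d \<sigma> ^ k /\<^sub>R fact k * \<psi> \<sigma>) sums (exp (d \<sigma>) * \<psi> \<sigma>)"
    by (intro sums_mult2 exp_converges)
  thus "op_exp (\<lambda>\<psi> \<sigma>. d \<sigma> * \<psi> \<sigma>) \<psi> \<sigma> = exp (d \<sigma>) * \<psi> \<sigma>"
    unfolding op_exp_def pow by (simp add: sums_iff scaleR_conv_of_real divide_inverse mult_ac)
qed

lemma qaoa_state_eq:
  assumes "finite V"
  shows "qaoa_state V E \<beta> \<gamma> = mixer (\<beta> / 2) V (phase_state V E \<gamma>)"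
proof -
  have "(\<lambda>\<psi> \<sigma>. - (\<i> * of_real \<gamma> / 2) * (\<Sum>e\<in>E. pauli_ZZ e \<psi> \<sigma>)) =
      (\<lambda>\<psi> \<sigma>. - (\<i> * of_real \<gamma> / 2) * of_int (energy E \<sigma>) * \<psi> \<sigma>)"
    by (simp add: fun_eq_iff energy_def pauli_ZZ_def pauli_Z_def sum_distrib_right sum_distrib_left mult_ac)
  thus ?thesis
    unfolding qaoa_state_def op_exp_mixer[OF assms]
    by (simp only: op_exp_diagonal) (simp add: phase_state_def plus_state_def cis_conv_exp mult_ac)
qed

section \<open>Inner products over cuts, and moving rotations past observables\<close>

definition inner_cuts :: "'a set \<Rightarrow> 'a state \<Rightarrow> 'a state \<Rightarrow> complex" where
  "inner_cuts V \<phi> \<psi> = (\<Sum>\<sigma>\<in>cuts V. cnj (\<phi> \<sigma>) * \<psi> \<sigma>)"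

lemma finite_cuts [simp]: "finite V \<Longrightarrow> finite (cuts V)"
  by (simp add: cuts_def finite_PiE)

lemma card_cuts: "finite V \<Longrightarrow> card (cuts V) = 2 ^ card V"
  by (simp add: cuts_def card_PiE numeral_2_eq_2)

lemma cuts_values: "\<sigma> \<in> cuts V \<Longrightarrow> v \<in> V \<Longrightarrow> \<sigma> v = 1 \<or> \<sigma> v = -1"
  by (auto simp: cuts_def PiE_def Pi_def)

lemma cuts_flip: "v \<in> V \<Longrightarrow> \<sigma> \<in> cuts V \<Longrightarrow> \<sigma>(v := - \<sigma> v) \<in> cuts V"
  by (fastforce simp: cuts_def PiE_def Pi_def extensional_def)

lemma sum_cuts_flip:
  assumes "v \<in> V"
  shows "(\<Sum>\<sigma>\<in>cuts V. f (\<sigma>(v := - \<sigma> v))) = sum f (cuts V)"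
  by (rule sum.reindex_bij_witness[of _ "\<lambda>\<sigma>. \<sigma>(v := - \<sigma> v)" "\<lambda>\<sigma>. \<sigma>(v := - \<sigma> v)"])
     (simp_all add: cuts_flip assms)

lemma inner_pauli_X:
  assumes "v \<in> V"
  shows "inner_cuts V (pauli_X v \<phi>) \<psi> = inner_cuts V \<phi> (pauli_X v \<psi>)"
  unfolding inner_cuts_def
  by (subst sum_cuts_flip[OF assms, symmetric]) (simp add: pauli_X_def)

lemma inner_rot:
  assumes "v \<in> V"
  shows "inner_cuts V (rot \<theta> v \<phi>) \<psi> = inner_cuts V \<phi> (rot (- \<theta>) v \<psi>)"
proof -
  have "inner_cuts V (rot \<theta> v \<phi>) \<psi> =
      of_real (cos \<theta>) * inner_cuts V \<phi> \<psi> + \<i> * of_real (sin \<theta>) * inner_cuts V (pauli_X v \<phi>) \<psi>"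
    by (simp add: inner_cuts_def rot_def sum.distrib sum_subtractf sum_distrib_left algebra_simps)
  also have "\<dots> = inner_cuts V \<phi> (rot (- \<theta>) v \<psi>)"
    unfolding inner_pauli_X[OF assms]
    by (simp add: inner_cuts_def rot_def sum.distrib sum_subtractf sum_distrib_left algebra_simps)
  finally show ?thesis .
qed

text \<open>\<open>D\<close> ignores the spins in \<open>W\<close>, hence commutes with their
  rotations. The adjoint of a rotation is the rotation by the opposite angle, so the two copies
  cancel one qubit at a time.\<close>

lemma inner_mixer_invariant:
  assumes "finite W" "W \<subseteq> V" "\<And>v \<sigma>. v \<in> W \<Longrightarrow> D (\<sigma>(v := - \<sigma> v)) = D \<sigma>"
  shows "inner_cuts V (mixer \<theta> W \<psi>) (\<lambda>\<sigma>. D \<sigma> * mixer \<theta> W \<psi> \<sigma>) = inner_cuts V \<psi> (\<lambda>\<sigma>. D \<sigma> * \<psi> \<sigma>)"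
  using assms
proof (induction W)
  case (insert v W)
  have "(\<lambda>\<sigma>. D \<sigma> * rot \<theta> v \<xi> \<sigma>) = rot \<theta> v (\<lambda>\<sigma>. D \<sigma> * \<xi> \<sigma>)" for \<xi>
    using insert.prems(2)[OF insertI1] by (simp add: rot_def pauli_X_def fun_eq_iff algebra_simps del: fun_upd_apply)
  then show ?case
    using insert by (simp add: inner_rot rot_rot)
qed simp

lemma inner_rot_anti:
  assumes "v \<in> V" "\<And>\<sigma>. D (\<sigma>(v := - \<sigma> v)) = - D \<sigma>"
  shows "inner_cuts V (rot \<theta> v \<phi>) (\<lambda>\<sigma>. D \<sigma> * rot \<theta> v \<psi> \<sigma>) =
    inner_cuts V \<phi> (\<lambda>\<sigma>. D \<sigma> * rot (2 * \<theta>) v \<psi> \<sigma>)"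
proof -
  have *: "(\<lambda>\<sigma>. D \<sigma> * rot \<eta> v \<xi> \<sigma>) = rot (- \<eta>) v (\<lambda>\<sigma>. D \<sigma> * \<xi> \<sigma>)" for \<xi> \<eta>
    using assms(2) by (simp add: rot_def pauli_X_def fun_eq_iff algebra_simps)
  show ?thesis
    unfolding * inner_rot[OF assms(1)] by (simp add: rot_rot)
qed

lemma measurement_expectation_inner:
  "of_real (measurement_expectation V \<psi> f) = inner_cuts V \<psi> (\<lambda>\<sigma>. of_real (f \<sigma>) * \<psi> \<sigma>)"
  by (simp add: measurement_expectation_def inner_cuts_def complex_norm_square mult_ac del: of_real_power)

lemma phase_norm:
  "cnj (phase_state V E \<gamma> \<sigma>) * phase_state V E \<gamma> \<tau> =
    cis (\<gamma> / 2 * of_int (energy E \<sigma> - energy E \<tau>)) / 2 ^ card V"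
proof -
  have "complex_of_real (sqrt (2 ^ card V)) * of_real (sqrt (2 ^ card V)) = 2 ^ card V"
    by (simp flip: of_real_mult)
  moreover have "cis (\<gamma> / 2 * of_int (energy E \<sigma>)) * cis (- (\<gamma> / 2) * of_int (energy E \<tau>)) =
      cis (\<gamma> / 2 * of_int (energy E \<sigma> - energy E \<tau>))"
    by (simp add: cis_mult algebra_simps)
  ultimately show ?thesis
    by (simp add: phase_state_def cis_cnj field_simps)
qed

text \<open>A constant is invariant under all flips, so the whole mixer cancels, and the phase state
  has uniform modulus. This is normalisation of the state; it handles the constant term of the gain
  and the trivial bounds on it.\<close>

lemma qaoa_norm:
  assumes "finite V"
  shows "measurement_expectation V (qaoa_state V E \<beta> \<gamma>) (\<lambda>_. c) = c"
proof -
  have "complex_of_real (measurement_expectation V (qaoa_state V E \<beta> \<gamma>) (\<lambda>_. c)) =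
      inner_cuts V (phase_state V E \<gamma>) (\<lambda>\<sigma>. of_real c * phase_state V E \<gamma> \<sigma>)"
    unfolding measurement_expectation_inner qaoa_state_eq[OF assms]
    by (rule inner_mixer_invariant) (use assms in auto)
  also have "\<dots> = of_real c * (\<Sum>\<sigma>\<in>cuts V. 1 / 2 ^ card V)"
    unfolding inner_cuts_def sum_distrib_left
    by (intro sum.cong refl) (use phase_norm[of V E \<gamma>] in \<open>simp add: mult.left_commute\<close>)
  also have "\<dots> = of_real c"
    by (simp add: card_cuts assms)
  finally show ?thesis by (simp only: of_real_eq_iff)
qed

text \<open>The rotations at the other qubits commute with \<open>Z\<^sub>a Z\<^sub>b\<close> and cancel; those at \<open>a\<close> and \<open>b\<close> are
  inverted when moved past it, so the two copies add up to the full angle \<open>\<beta>\<close>.\<close>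

lemma qaoa_correlation_Heisenberg:
  assumes "finite V" "a \<in> V" "b \<in> V" "a \<noteq> b"
  shows "of_real (measurement_expectation V (qaoa_state V E \<beta> \<gamma>) (\<lambda>\<sigma>. of_int (\<sigma> a * \<sigma> b))) =
    inner_cuts V (phase_state V E \<gamma>) (\<lambda>\<sigma>. of_int (\<sigma> a * \<sigma> b) * rot \<beta> a (rot \<beta> b (phase_state V E \<gamma>)) \<sigma>)"
proof -
  let ?\<phi> = "phase_state V E \<gamma>" and ?D = "\<lambda>\<sigma>. complex_of_int (\<sigma> a * \<sigma> b)"
  let ?W = "V - {a, b}"
  have V: "V = insert a (insert b ?W)" using assms by auto
  have "mixer (\<beta> / 2) V ?\<phi> = mixer (\<beta> / 2) ?W (rot (\<beta> / 2) a (rot (\<beta> / 2) b ?\<phi>))"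
    unfolding arg_cong[OF V, of "\<lambda>V'. mixer (\<beta> / 2) V' ?\<phi>"]
    using assms by (simp add: rot.fold_insert2 rot_commute[of _ b _ a] del: rot.fold_insert)
  then have "of_real (measurement_expectation V (qaoa_state V E \<beta> \<gamma>) (\<lambda>\<sigma>. of_int (\<sigma> a * \<sigma> b))) =
      inner_cuts V (rot (\<beta> / 2) a (rot (\<beta> / 2) b ?\<phi>))
        (\<lambda>\<sigma>. ?D \<sigma> * rot (\<beta> / 2) a (rot (\<beta> / 2) b ?\<phi>) \<sigma>)"
    unfolding measurement_expectation_inner qaoa_state_eq[OF assms(1)]
    by (simp only: of_real_of_int_eq) (rule inner_mixer_invariant, use assms in auto)
  also have "\<dots> = inner_cuts V (rot (\<beta> / 2) b ?\<phi>) (\<lambda>\<sigma>. ?D \<sigma> * rot (\<beta> / 2) b (rot \<beta> a ?\<phi>) \<sigma>)"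
    using inner_rot_anti[of a V ?D "\<beta> / 2"] assms by (simp add: rot_commute)
  also have "\<dots> = inner_cuts V ?\<phi> (\<lambda>\<sigma>. ?D \<sigma> * rot \<beta> a (rot \<beta> b ?\<phi>) \<sigma>)"
    using inner_rot_anti[of b V ?D "\<beta> / 2"] assms by (simp add: rot_commute[of _ a])
  finally show ?thesis .
qed

section \<open>Two-point correlations\<close>

definition nbrs :: "'a set set \<Rightarrow> 'a \<Rightarrow> 'a set" where
  "nbrs E v = {w. {v, w} \<in> E}"

lemma nbrs_sym: "w \<in> nbrs E v \<longleftrightarrow> v \<in> nbrs E w"
  by (simp add: nbrs_def insert_commute)

definition graph_on :: "'a set \<Rightarrow> 'a set set \<Rightarrow> bool" where
  "graph_on V E \<longleftrightarrow> finite V \<and> (\<forall>e\<in>E. e \<subseteq> V \<and> card e = 2)"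

lemma graph_on_finite: "graph_on V E \<Longrightarrow> finite V" "graph_on V E \<Longrightarrow> finite E"
  unfolding graph_on_def by (blast, rule finite_subset[of _ "Pow V"]) auto

lemma nbrs_subset: "graph_on V E \<Longrightarrow> nbrs E v \<subseteq> V"
  by (auto simp: graph_on_def nbrs_def)

lemma nbrs_vertex: "graph_on V E \<Longrightarrow> w \<in> nbrs E v \<Longrightarrow> v \<in> V"
  by (auto simp: graph_on_def nbrs_def)

lemma finite_nbrs: "graph_on V E \<Longrightarrow> finite (nbrs E v)"
  by (rule finite_subset[OF nbrs_subset graph_on_finite(1)])

lemma nbrs_irrefl: "graph_on V E \<Longrightarrow> v \<notin> nbrs E v"
  by (force simp: graph_on_def nbrs_def)

lemma incident_edges:
  assumes "graph_on V E"
  shows "{e \<in> E. v \<in> e} = (\<lambda>w. {v, w}) ` nbrs E v"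
proof -
  have "e \<in> (\<lambda>w. {v, w}) ` nbrs E v" if "e \<in> E" "v \<in> e" for e
  proof -
    have "card e = 2" using assms that by (auto simp: graph_on_def)
    then obtain x y where "e = {x, y}" by (auto simp: card_2_iff)
    with that show ?thesis by (auto simp: nbrs_def insert_commute)
  qed
  then show ?thesis by (auto simp: nbrs_def)
qed

lemma inj_on_edge: "inj_on (\<lambda>w. {v, w}) W"
  by (auto simp: inj_on_def doubleton_eq_iff)

lemma card_incident_edges:
  assumes "graph_on V E"
  shows "card {e \<in> E. v \<in> e} = card (nbrs E v)"
  by (simp add: incident_edges[OF assms] card_image inj_on_edge)

lemma edge_product: "\<sigma> (Min {u, v}) * \<sigma> (Max {u, v}) = \<sigma> u * (\<sigma> v :: int)" for u v :: "'a::linorder"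
  by (simp add: min_def max_def)

lemma energy_flip:
  assumes "graph_on V E"
  shows "energy E \<sigma> - energy E (\<sigma>(a := - \<sigma> a)) = 2 * \<sigma> a * (\<Sum>w\<in>nbrs E a. \<sigma> w)"
proof -
  let ?q = "\<lambda>\<sigma> e. \<sigma> (Min e) * \<sigma> (Max e) :: int" and ?\<tau> = "\<sigma>(a := - \<sigma> a)"
  let ?Ea = "{e \<in> E. a \<in> e}" and ?Eb = "{e \<in> E. a \<notin> e}"
  have fin: "finite E" by (rule graph_on_finite(2)[OF assms])
  have split: "energy E \<rho> = sum (?q \<rho>) ?Ea + sum (?q \<rho>) ?Eb" for \<rho> :: "'a \<Rightarrow> int"
    unfolding energy_def using fin
    by (subst sum.union_disjoint[symmetric]) (auto intro!: sum.cong)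
  have Ea: "sum (?q \<rho>) ?Ea = (\<Sum>w\<in>nbrs E a. \<rho> a * \<rho> w)" for \<rho> :: "'a \<Rightarrow> int"
    unfolding incident_edges[OF assms] by (simp only: sum.reindex[OF inj_on_edge] o_def edge_product)
  have "(\<Sum>w\<in>nbrs E a. ?\<tau> a * ?\<tau> w) = (\<Sum>w\<in>nbrs E a. - (\<sigma> a * \<sigma> w))"
    using nbrs_irrefl[OF assms, of a] by (intro sum.cong) auto
  moreover have "sum (?q ?\<tau>) ?Eb = sum (?q \<sigma>) ?Eb"
  proof (rule sum.cong)
    fix e assume e: "e \<in> ?Eb"
    then have "card e = 2" using assms by (auto simp: graph_on_def)
    then have "finite e" "e \<noteq> {}" by (auto intro: card_ge_0_finite)
    then have "Min e \<in> e" "Max e \<in> e" by auto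
    then show "?q ?\<tau> e = ?q \<sigma> e" using e by auto
  qed simp
  ultimately show ?thesis
    unfolding split Ea by (simp add: sum_negf sum_distrib_left mult.assoc del: fun_upd_apply)
qed

text \<open>A flip of \<open>u\<close> reverses the sign of the edge term, so the energy changes by
  twice that term; hence the full angle \<open>\<gamma>\<close> here against the half angle in
  \<open>phase_state\<close>.\<close>

definition edge_phase :: "real \<Rightarrow> 'a \<Rightarrow> 'a \<Rightarrow> ('a \<Rightarrow> int) \<Rightarrow> complex" where
  "edge_phase \<gamma> u v \<sigma> = cis (\<gamma> * of_int (\<sigma> u * \<sigma> v))"

lemma edge_phase_eq:
  assumes "\<sigma> \<in> cuts V" "u \<in> V" "v \<in> V"
  shows "edge_phase \<gamma> u v \<sigma> = of_real (cos \<gamma>) + \<i> * of_real (sin \<gamma>) * of_int (\<sigma> u * \<sigma> v)"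
proof -
  have "\<sigma> u * \<sigma> v = 1 \<or> \<sigma> u * \<sigma> v = -1"
    using cuts_values[OF assms(1,2)] cuts_values[OF assms(1,3)] by auto
  then show ?thesis
    unfolding edge_phase_def by (elim disjE; simp only:) (simp_all add: complex_eq_iff)
qed

lemma cis_sum: "finite W \<Longrightarrow> cis (\<Sum>w\<in>W. f w) = (\<Prod>w\<in>W. cis (f w))"
proof (induction W rule: finite_induct)
  case (insert x W)
  then show ?case
    unfolding sum.insert[OF insert.hyps] prod.insert[OF insert.hyps] insert.IH[symmetric] cis_mult by simp
qed simp

lemma prod_edge_phase:
  assumes "finite W"
  shows "(\<Prod>w\<in>W. edge_phase \<gamma> a w \<sigma>) = cis (\<gamma> * of_int (\<sigma> a * (\<Sum>w\<in>W. \<sigma> w)))"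
  unfolding edge_phase_def cis_sum[OF assms, symmetric]
  by (simp only: sum_distrib_left of_int_sum)

lemma phase_flip:
  assumes "graph_on V E"
  shows "cnj (phase_state V E \<gamma> \<sigma>) * phase_state V E \<gamma> (\<sigma>(a := - \<sigma> a)) =
    (\<Prod>w\<in>nbrs E a. edge_phase \<gamma> a w \<sigma>) / 2 ^ card V"
  unfolding phase_norm energy_flip[OF assms] prod_edge_phase[OF finite_nbrs[OF assms]]
  by simp

text \<open>An edge \<open>{a, b}\<close>, if present, is flipped at both ends and keeps its energy,
  so each product omits the other vertex. If \<open>a\<close> and \<open>b\<close> are not adjacent,
  these deletions are vacuous.\<close>

lemma phase_flip_flip:
  assumes "graph_on V E" "a \<noteq> b"
  shows "cnj (phase_state V E \<gamma> \<sigma>) * phase_state V E \<gamma> (\<sigma>(a := - \<sigma> a, b := - \<sigma> b)) =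
    (\<Prod>w\<in>nbrs E a - {b}. edge_phase \<gamma> a w \<sigma>) * (\<Prod>w\<in>nbrs E b - {a}. edge_phase \<gamma> b w \<sigma>) / 2 ^ card V"
proof -
  let ?\<tau> = "\<sigma>(a := - \<sigma> a)"
  let ?S = "\<lambda>x y. \<sigma> x * (\<Sum>w\<in>nbrs E x - {y}. \<sigma> w)"
  have fin: "finite (nbrs E x)" for x by (rule finite_nbrs[OF assms(1)])
  have 1: "energy E \<sigma> - energy E ?\<tau> = 2 * \<sigma> a * (\<Sum>w\<in>nbrs E a. \<sigma> w)"
    by (rule energy_flip[OF assms(1)])
  have 2: "energy E ?\<tau> - energy E (?\<tau>(b := - ?\<tau> b)) = 2 * ?\<tau> b * (\<Sum>w\<in>nbrs E b. ?\<tau> w)"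
    by (rule energy_flip[OF assms(1)])
  have cong: "(\<Sum>w\<in>nbrs E b - {a}. ?\<tau> w) = (\<Sum>w\<in>nbrs E b - {a}. \<sigma> w)"
    by (rule sum.cong) auto
  have "energy E \<sigma> - energy E (\<sigma>(a := - \<sigma> a, b := - \<sigma> b)) = 2 * (?S a b + ?S b a)"
  proof (cases "b \<in> nbrs E a")
    case True
    then have "a \<in> nbrs E b" by (simp add: nbrs_sym)
    have "(\<Sum>w\<in>nbrs E b. ?\<tau> w) = - \<sigma> a + (\<Sum>w\<in>nbrs E b - {a}. \<sigma> w)"
      using sum.remove[OF fin \<open>a \<in> nbrs E b\<close>, of ?\<tau>] cong by simp
    from 2[unfolded this] 1 show ?thesis
      using assms(2) sum.remove[OF fin True, of \<sigma>] by (simp add: algebra_simps)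
  next
    case False
    then have "a \<notin> nbrs E b" by (simp add: nbrs_sym)
    show ?thesis
      using 1 2 assms(2) cong False \<open>a \<notin> nbrs E b\<close> by (simp add: algebra_simps)
  qed
  then show ?thesis
    unfolding phase_norm by (simp add: prod_edge_phase fin cis_mult algebra_simps)
qed

text \<open>Flipping one spin permutes the cuts, so the sum equals its own negative. Every term with
  an unpaired spin disappears in this way.\<close>

lemma sum_cuts_odd:
  assumes "v \<in> V" "\<And>\<sigma>. f (\<sigma>(v := - \<sigma> v)) = - f \<sigma>"
  shows "sum f (cuts V) = (0 :: complex)"
proof -
  have "sum f (cuts V) = - sum f (cuts V)"
    by (subst (1) sum_cuts_flip[OF assms(1), symmetric]) (simp only: assms(2) sum_negf)
  then show ?thesis by simp
qed

text \<open>A vertex occurring in a single edge phase can be averaged out, which turns that phase into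
  its even part \<open>cos \<gamma>\<close>.\<close>

lemma sum_leaves:
  assumes "finite W" "W \<subseteq> V" "\<And>w. w \<in> W \<Longrightarrow> p w \<in> V - W"
    and "\<And>w \<sigma>. w \<in> W \<Longrightarrow> g (\<sigma>(w := - \<sigma> w)) = g \<sigma>"
  shows "(\<Sum>\<sigma>\<in>cuts V. g \<sigma> * (\<Prod>w\<in>W. edge_phase \<gamma> (p w) w \<sigma>)) =
    of_real (cos \<gamma> ^ card W) * (\<Sum>\<sigma>\<in>cuts V. g \<sigma>)"
  using assms
proof (induction W)
  case (insert x W)
  let ?g = "\<lambda>\<sigma>. g \<sigma> * (\<Prod>w\<in>W. edge_phase \<gamma> (p w) w \<sigma>)"
  have p: "p w \<in> V" "p w \<noteq> x" if "w \<in> insert x W" for w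
    using insert.prems(2)[OF that] by auto
  have x: "x \<in> V" using insert.prems by simp
  have "(\<Prod>w\<in>W. edge_phase \<gamma> (p w) w (\<sigma>(x := - \<sigma> x))) = (\<Prod>w\<in>W. edge_phase \<gamma> (p w) w \<sigma>)" for \<sigma>
    using p insert.hyps by (intro prod.cong) (auto simp: edge_phase_def)
  then have inv: "?g (\<sigma>(x := - \<sigma> x)) = ?g \<sigma>" for \<sigma>
    using insert.prems(3)[of x] by (simp del: fun_upd_apply)
  have odd: "(\<Sum>\<sigma>\<in>cuts V. ?g \<sigma> * of_int (\<sigma> (p x) * \<sigma> x)) = 0"
    by (rule sum_cuts_odd[OF x]) (use inv p[of x] in simp)
  have "(\<Sum>\<sigma>\<in>cuts V. g \<sigma> * (\<Prod>w\<in>insert x W. edge_phase \<gamma> (p w) w \<sigma>)) =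
      (\<Sum>\<sigma>\<in>cuts V. ?g \<sigma> * edge_phase \<gamma> (p x) x \<sigma>)"
    using insert.hyps by (simp add: mult_ac)
  also have "\<dots> = (\<Sum>\<sigma>\<in>cuts V. of_real (cos \<gamma>) * ?g \<sigma> +
      \<i> * of_real (sin \<gamma>) * (?g \<sigma> * of_int (\<sigma> (p x) * \<sigma> x)))"
    by (rule sum.cong) (use p[of x] x in \<open>auto simp: edge_phase_eq algebra_simps\<close>)
  also have "\<dots> = of_real (cos \<gamma>) * sum ?g (cuts V)"
    unfolding sum.distrib sum_distrib_left[symmetric] odd by simp
  also have "sum ?g (cuts V) = of_real (cos \<gamma> ^ card W) * (\<Sum>\<sigma>\<in>cuts V. g \<sigma>)"
    using insert.prems by (intro insert.IH) auto
  finally show ?case using insert.hyps by simp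
qed simp

text \<open>The two rotations expand into four terms: no flip, a flip at one of the two ends, a flip
  at both. The first averages \<open>Z_a Z_b\<close> over uniform cuts and vanishes; in the others
  the amplitudes combine to products of edge phases.\<close>

lemma qaoa_correlation_expand:
  assumes G: "graph_on V E" and ab: "a \<in> V" "b \<in> V" "a \<noteq> b"
  shows "2 ^ card V * of_real (measurement_expectation V (qaoa_state V E \<beta> \<gamma>) (\<lambda>\<sigma>. of_int (\<sigma> a * \<sigma> b))) =
    - \<i> * of_real (sin \<beta> * cos \<beta>) *
      ((\<Sum>\<sigma>\<in>cuts V. of_int (\<sigma> a * \<sigma> b) * (\<Prod>w\<in>nbrs E a. edge_phase \<gamma> a w \<sigma>)) +
       (\<Sum>\<sigma>\<in>cuts V. of_int (\<sigma> a * \<sigma> b) * (\<Prod>w\<in>nbrs E b. edge_phase \<gamma> b w \<sigma>))) -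
    of_real ((sin \<beta>)\<^sup>2) * (\<Sum>\<sigma>\<in>cuts V. of_int (\<sigma> a * \<sigma> b) *
      ((\<Prod>w\<in>nbrs E a - {b}. edge_phase \<gamma> a w \<sigma>) * (\<Prod>w\<in>nbrs E b - {a}. edge_phase \<gamma> b w \<sigma>)))"
    (is "?N * ?lhs = _")
proof -
  let ?\<phi> = "phase_state V E \<gamma>" and ?D = "\<lambda>\<sigma>. complex_of_int (\<sigma> a * \<sigma> b)"
  have fin: "finite V" using G by (rule graph_on_finite)
  have "?N * (cnj (?\<phi> \<sigma>) * (?D \<sigma> * rot \<beta> a (rot \<beta> b ?\<phi>) \<sigma>)) =
      of_real ((cos \<beta>)\<^sup>2) * ?D \<sigma>
      - \<i> * of_real (sin \<beta> * cos \<beta>) * (?D \<sigma> * (\<Prod>w\<in>nbrs E a. edge_phase \<gamma> a w \<sigma>))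
      - \<i> * of_real (sin \<beta> * cos \<beta>) * (?D \<sigma> * (\<Prod>w\<in>nbrs E b. edge_phase \<gamma> b w \<sigma>))
      - of_real ((sin \<beta>)\<^sup>2) * (?D \<sigma> *
          ((\<Prod>w\<in>nbrs E a - {b}. edge_phase \<gamma> a w \<sigma>) * (\<Prod>w\<in>nbrs E b - {a}. edge_phase \<gamma> b w \<sigma>)))"
    for \<sigma>
  proof -
    let ?c = "complex_of_real (cos \<beta>)" and ?s = "complex_of_real (sin \<beta>)"
    have 0: "?N * (cnj (?\<phi> \<sigma>) * ?\<phi> \<sigma>) = 1"
      unfolding phase_norm by simp
    have 1: "?N * (cnj (?\<phi> \<sigma>) * ?\<phi> (\<sigma>(x := - \<sigma> x))) = (\<Prod>w\<in>nbrs E x. edge_phase \<gamma> x w \<sigma>)" for x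
      unfolding phase_flip[OF G] by simp
    have 2: "?N * (cnj (?\<phi> \<sigma>) * ?\<phi> (\<sigma>(a := - \<sigma> a, b := - \<sigma> b))) =
        (\<Prod>w\<in>nbrs E a - {b}. edge_phase \<gamma> a w \<sigma>) * (\<Prod>w\<in>nbrs E b - {a}. edge_phase \<gamma> b w \<sigma>)"
      unfolding phase_flip_flip[OF G ab(3)] by simp
    have "rot \<beta> a (rot \<beta> b ?\<phi>) \<sigma> = ?c * ?c * ?\<phi> \<sigma> - \<i> * (?s * ?c) * ?\<phi> (\<sigma>(a := - \<sigma> a))
        - \<i> * (?s * ?c) * ?\<phi> (\<sigma>(b := - \<sigma> b)) - ?s * ?s * ?\<phi> (\<sigma>(a := - \<sigma> a, b := - \<sigma> b))"
      using ab(3) by (simp add: rot_def pauli_X_def algebra_simps)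
    then have "?N * (cnj (?\<phi> \<sigma>) * (?D \<sigma> * rot \<beta> a (rot \<beta> b ?\<phi>) \<sigma>)) =
        ?c * ?c * ?D \<sigma> * (?N * (cnj (?\<phi> \<sigma>) * ?\<phi> \<sigma>))
        - \<i> * (?s * ?c) * (?D \<sigma> * (?N * (cnj (?\<phi> \<sigma>) * ?\<phi> (\<sigma>(a := - \<sigma> a)))))
        - \<i> * (?s * ?c) * (?D \<sigma> * (?N * (cnj (?\<phi> \<sigma>) * ?\<phi> (\<sigma>(b := - \<sigma> b)))))
        - ?s * ?s * (?D \<sigma> * (?N * (cnj (?\<phi> \<sigma>) * ?\<phi> (\<sigma>(a := - \<sigma> a, b := - \<sigma> b)))))"
      by (simp only: right_diff_distrib mult_ac)
    then show ?thesis
      unfolding 0 1 2 by (simp only: power2_eq_square of_real_mult mult_1_right)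
  qed
  note expand = this
  have D0: "sum ?D (cuts V) = 0"
    by (rule sum_cuts_odd[OF ab(1)]) (use ab in simp)
  have "?N * ?lhs = (\<Sum>\<sigma>\<in>cuts V. ?N * (cnj (?\<phi> \<sigma>) * (?D \<sigma> * rot \<beta> a (rot \<beta> b ?\<phi>) \<sigma>)))"
    unfolding qaoa_correlation_Heisenberg[OF fin ab] inner_cuts_def sum_distrib_left ..
  also have "\<dots> = of_real ((cos \<beta>)\<^sup>2) * sum ?D (cuts V)
      - \<i> * of_real (sin \<beta> * cos \<beta>) * (\<Sum>\<sigma>\<in>cuts V. ?D \<sigma> * (\<Prod>w\<in>nbrs E a. edge_phase \<gamma> a w \<sigma>))
      - \<i> * of_real (sin \<beta> * cos \<beta>) * (\<Sum>\<sigma>\<in>cuts V. ?D \<sigma> * (\<Prod>w\<in>nbrs E b. edge_phase \<gamma> b w \<sigma>))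
      - of_real ((sin \<beta>)\<^sup>2) * (\<Sum>\<sigma>\<in>cuts V. ?D \<sigma> *
      ((\<Prod>w\<in>nbrs E a - {b}. edge_phase \<gamma> a w \<sigma>) * (\<Prod>w\<in>nbrs E b - {a}. edge_phase \<gamma> b w \<sigma>)))"
    unfolding expand sum_subtractf sum_distrib_left[symmetric] ..
  finally show ?thesis unfolding D0 by (simp only: mult_zero_right) (simp add: distrib_left del: of_int_mult)
qed

lemma sum_nbrs_leaves:
  assumes G: "graph_on V E" and a: "a \<in> V" and "W \<subseteq> nbrs E a"
    and "\<And>w \<sigma>. w \<in> W \<Longrightarrow> g (\<sigma>(w := - \<sigma> w)) = g \<sigma>"
  shows "(\<Sum>\<sigma>\<in>cuts V. g \<sigma> * (\<Prod>w\<in>W. edge_phase \<gamma> a w \<sigma>)) =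
    of_real (cos \<gamma> ^ card W) * (\<Sum>\<sigma>\<in>cuts V. g \<sigma>)"
  using assms nbrs_subset[OF G, of a] nbrs_irrefl[OF G, of a] finite_subset[OF _ finite_nbrs[OF G, of a]]
  by (intro sum_leaves) auto

text \<open>With one flip, the phase on \<open>{a, b}\<close> contributes
  \<open>\<i> sin \<gamma>\<close>, its two spins cancelling those of the observable, and every
  other edge at the flipped end contributes \<open>cos \<gamma>\<close>. With two flips that phase
  is absent; as there is no common neighbour, all remaining phases average out and leave the mean of
  \<open>Z_a Z_b\<close>, which is zero.\<close>

lemma qaoa_correlation_adjacent:
  assumes G: "graph_on V E" and ab: "b \<in> nbrs E a" and tri: "nbrs E a \<inter> nbrs E b = {}"
  shows "measurement_expectation V (qaoa_state V E \<beta> \<gamma>) (\<lambda>\<sigma>. of_int (\<sigma> a * \<sigma> b)) =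
    sin \<beta> * cos \<beta> * sin \<gamma> * (cos \<gamma> ^ (card (nbrs E a) - 1) + cos \<gamma> ^ (card (nbrs E b) - 1))"
    (is "?lhs = ?rhs")
proof -
  let ?D = "\<lambda>\<sigma>. complex_of_int (\<sigma> a * \<sigma> b)"
  have fin: "finite V" using G by (rule graph_on_finite)
  have ba: "a \<in> nbrs E b" using ab by (simp add: nbrs_sym)
  have V: "a \<in> V" "b \<in> V" using nbrs_vertex[OF G ab] nbrs_vertex[OF G ba] .
  have ne: "a \<noteq> b" using nbrs_irrefl[OF G] ab by auto
  have D0: "sum ?D (cuts V) = 0"
    by (rule sum_cuts_odd[OF V(1)]) (use ne in simp)
  have one: "(\<Sum>\<sigma>\<in>cuts V. complex_of_int (\<sigma> x * \<sigma> y) * (\<Prod>w\<in>nbrs E x. edge_phase \<gamma> x w \<sigma>)) =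
      2 ^ card V * (\<i> * of_real (sin \<gamma> * cos \<gamma> ^ (card (nbrs E x) - 1)))"
    if xy: "x \<in> V" "y \<in> V" "y \<in> nbrs E x" for x y
  proof -
    let ?D' = "\<lambda>\<sigma>. complex_of_int (\<sigma> x * \<sigma> y)"
    have xy': "x \<noteq> y" using xy nbrs_irrefl[OF G] by auto
    have D'0: "sum ?D' (cuts V) = 0"
      by (rule sum_cuts_odd[OF xy(1)]) (use xy' in simp)
    have "(\<Sum>\<sigma>\<in>cuts V. ?D' \<sigma> * (\<Prod>w\<in>nbrs E x. edge_phase \<gamma> x w \<sigma>)) =
        (\<Sum>\<sigma>\<in>cuts V. (?D' \<sigma> * edge_phase \<gamma> x y \<sigma>) * (\<Prod>w\<in>nbrs E x - {y}. edge_phase \<gamma> x w \<sigma>))"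
      by (simp add: prod.remove[OF finite_nbrs[OF G] xy(3)] mult_ac)
    also have "\<dots> = of_real (cos \<gamma> ^ card (nbrs E x - {y})) * (\<Sum>\<sigma>\<in>cuts V. ?D' \<sigma> * edge_phase \<gamma> x y \<sigma>)"
      by (rule sum_nbrs_leaves[OF G xy(1)]) (use nbrs_irrefl[OF G, of x] in \<open>auto simp: edge_phase_def\<close>)
    also have "(\<Sum>\<sigma>\<in>cuts V. ?D' \<sigma> * edge_phase \<gamma> x y \<sigma>) =
        (\<Sum>\<sigma>\<in>cuts V. of_real (cos \<gamma>) * ?D' \<sigma> + \<i> * of_real (sin \<gamma>))"
    proof (rule sum.cong)
      fix \<sigma> assume \<sigma>: "\<sigma> \<in> cuts V"
      show "?D' \<sigma> * edge_phase \<gamma> x y \<sigma> = of_real (cos \<gamma>) * ?D' \<sigma> + \<i> * of_real (sin \<gamma>)"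
        using cuts_values[OF \<sigma> xy(1)] cuts_values[OF \<sigma> xy(2)]
        by (auto simp: edge_phase_eq[OF \<sigma> xy(1,2)])
    qed simp
    also have "\<dots> = 2 ^ card V * (\<i> * of_real (sin \<gamma>))"
      unfolding sum.distrib sum_distrib_left[symmetric] D'0 by (simp add: card_cuts[OF fin])
    finally show ?thesis
      using xy(3) finite_nbrs[OF G] by (simp add: mult_ac card_Diff_singleton)
  qed
  have two: "(\<Sum>\<sigma>\<in>cuts V. ?D \<sigma> *
      ((\<Prod>w\<in>nbrs E a - {b}. edge_phase \<gamma> a w \<sigma>) * (\<Prod>w\<in>nbrs E b - {a}. edge_phase \<gamma> b w \<sigma>))) = 0"
  proof -
    have "(\<Sum>\<sigma>\<in>cuts V. (?D \<sigma> * (\<Prod>w\<in>nbrs E a - {b}. edge_phase \<gamma> a w \<sigma>)) *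
        (\<Prod>w\<in>nbrs E b - {a}. edge_phase \<gamma> b w \<sigma>)) =
      of_real (cos \<gamma> ^ card (nbrs E b - {a})) *
        (\<Sum>\<sigma>\<in>cuts V. ?D \<sigma> * (\<Prod>w\<in>nbrs E a - {b}. edge_phase \<gamma> a w \<sigma>))"
    proof (rule sum_nbrs_leaves[OF G V(2)])
      fix w \<sigma> assume w: "w \<in> nbrs E b - {a}"
      then have "w \<noteq> b" "a \<noteq> w" "w \<notin> nbrs E a" using nbrs_irrefl[OF G, of b] tri by auto
      with w have "(\<Prod>u\<in>nbrs E a - {b}. edge_phase \<gamma> a u (\<sigma>(w := - \<sigma> w))) =
          (\<Prod>u\<in>nbrs E a - {b}. edge_phase \<gamma> a u \<sigma>)"
        by (intro prod.cong) (auto simp: edge_phase_def)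
      with w \<open>w \<noteq> b\<close> \<open>a \<noteq> w\<close> show "?D (\<sigma>(w := - \<sigma> w)) * (\<Prod>u\<in>nbrs E a - {b}. edge_phase \<gamma> a u (\<sigma>(w := - \<sigma> w))) =
          ?D \<sigma> * (\<Prod>u\<in>nbrs E a - {b}. edge_phase \<gamma> a u \<sigma>)"
        by simp
    qed auto
    also have "(\<Sum>\<sigma>\<in>cuts V. ?D \<sigma> * (\<Prod>w\<in>nbrs E a - {b}. edge_phase \<gamma> a w \<sigma>)) =
        of_real (cos \<gamma> ^ card (nbrs E a - {b})) * sum ?D (cuts V)"
      by (rule sum_nbrs_leaves[OF G V(1)]) (use nbrs_irrefl[OF G, of a] in auto)
    finally show ?thesis unfolding D0 by (simp add: mult.assoc)
  qed
  have "2 ^ card V * complex_of_real ?lhs = 2 ^ card V * complex_of_real ?rhs"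
    unfolding qaoa_correlation_expand[OF G V ne] two one[OF V ab]
    using one[OF V(2,1) ba]
    by (simp add: mult.commute[of "\<sigma> b" "\<sigma> a" for \<sigma>] algebra_simps)
  then show ?thesis by (simp only: mult_cancel_left of_real_eq_iff) simp
qed

text \<open>A single flip leaves the spin at the other end unpaired and gives zero. With two flips,
  both phases at the common neighbour \<open>v\<close> must contribute
  \<open>\<i> sin \<gamma>\<close> to pair off the spins of \<open>a\<close> and \<open>b\<close>;
  the square of \<open>\<i>\<close> cancels the minus sign of the double-flip term. The remaining
  edges give the powers of \<open>cos \<gamma>\<close>.\<close>

lemma qaoa_correlation_distance_two:
  assumes G: "graph_on V E" and ab: "a \<noteq> b" "b \<notin> nbrs E a"
    and v: "nbrs E a \<inter> nbrs E b = {v}"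
  shows "measurement_expectation V (qaoa_state V E \<beta> \<gamma>) (\<lambda>\<sigma>. of_int (\<sigma> a * \<sigma> b)) =
    (sin \<beta>)\<^sup>2 * (sin \<gamma>)\<^sup>2 * cos \<gamma> ^ (card (nbrs E a) - 1 + (card (nbrs E b) - 1))"
    (is "?lhs = ?rhs")
proof -
  let ?D = "\<lambda>\<sigma>. complex_of_int (\<sigma> a * \<sigma> b)"
  have fin: "finite V" using G by (rule graph_on_finite)
  have va: "v \<in> nbrs E a" and vb: "v \<in> nbrs E b" using v by auto
  have V: "a \<in> V" "b \<in> V" "v \<in> V"
    using nbrs_vertex[OF G va] nbrs_vertex[OF G vb] nbrs_subset[OF G] va by auto
  have ne: "v \<noteq> a" "v \<noteq> b" using nbrs_irrefl[OF G] va vb by auto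
  have ba: "a \<notin> nbrs E b" using ab by (simp add: nbrs_sym)
  have zero: "(\<Sum>\<sigma>\<in>cuts V. ?D \<sigma> * (\<Prod>w\<in>nbrs E x. edge_phase \<gamma> x w \<sigma>)) = 0"
    if xy: "{x, y} = {a, b}" for x y
  proof (rule sum_cuts_odd[of y])
    show "y \<in> V" using xy V by (auto simp: doubleton_eq_iff)
    fix \<sigma>
    have "x \<noteq> y" "y \<notin> nbrs E x" using xy ab ba by (auto simp: doubleton_eq_iff)
    then have "(\<Prod>w\<in>nbrs E x. edge_phase \<gamma> x w (\<sigma>(y := - \<sigma> y))) = (\<Prod>w\<in>nbrs E x. edge_phase \<gamma> x w \<sigma>)"
      by (intro prod.cong) (auto simp: edge_phase_def)
    moreover have "?D (\<sigma>(y := - \<sigma> y)) = - ?D \<sigma>"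
      using xy ab by (auto simp: doubleton_eq_iff)
    ultimately show "?D (\<sigma>(y := - \<sigma> y)) * (\<Prod>w\<in>nbrs E x. edge_phase \<gamma> x w (\<sigma>(y := - \<sigma> y))) =
        - (?D \<sigma> * (\<Prod>w\<in>nbrs E x. edge_phase \<gamma> x w \<sigma>))"
      by simp
  qed
  let ?g = "\<lambda>\<sigma>. ?D \<sigma> * edge_phase \<gamma> a v \<sigma> * edge_phase \<gamma> b v \<sigma>"
  have "(\<Sum>\<sigma>\<in>cuts V. ?D \<sigma> *
      ((\<Prod>w\<in>nbrs E a - {b}. edge_phase \<gamma> a w \<sigma>) * (\<Prod>w\<in>nbrs E b - {a}. edge_phase \<gamma> b w \<sigma>))) =
    (\<Sum>\<sigma>\<in>cuts V. (?g \<sigma> * (\<Prod>w\<in>nbrs E a - {v}. edge_phase \<gamma> a w \<sigma>)) *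
      (\<Prod>w\<in>nbrs E b - {v}. edge_phase \<gamma> b w \<sigma>))"
    using ab ba by (simp add: prod.remove[OF finite_nbrs[OF G] va] prod.remove[OF finite_nbrs[OF G] vb] mult_ac)
  also have "\<dots> = of_real (cos \<gamma> ^ card (nbrs E b - {v})) *
      (\<Sum>\<sigma>\<in>cuts V. ?g \<sigma> * (\<Prod>w\<in>nbrs E a - {v}. edge_phase \<gamma> a w \<sigma>))"
  proof (rule sum_nbrs_leaves[OF G V(2)])
    fix w \<sigma> assume w: "w \<in> nbrs E b - {v}"
    then have "w \<noteq> b" "w \<noteq> a" "w \<noteq> v" "w \<notin> nbrs E a" using nbrs_irrefl[OF G, of b] v ba by auto
    moreover from this have "(\<Prod>u\<in>nbrs E a - {v}. edge_phase \<gamma> a u (\<sigma>(w := - \<sigma> w))) =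
        (\<Prod>u\<in>nbrs E a - {v}. edge_phase \<gamma> a u \<sigma>)"
      by (intro prod.cong) (auto simp: edge_phase_def)
    ultimately show "?g (\<sigma>(w := - \<sigma> w)) * (\<Prod>u\<in>nbrs E a - {v}. edge_phase \<gamma> a u (\<sigma>(w := - \<sigma> w))) =
        ?g \<sigma> * (\<Prod>u\<in>nbrs E a - {v}. edge_phase \<gamma> a u \<sigma>)"
      by (simp add: edge_phase_def)
  qed auto
  also have "(\<Sum>\<sigma>\<in>cuts V. ?g \<sigma> * (\<Prod>w\<in>nbrs E a - {v}. edge_phase \<gamma> a w \<sigma>)) =
      of_real (cos \<gamma> ^ card (nbrs E a - {v})) * sum ?g (cuts V)"
    by (rule sum_nbrs_leaves[OF G V(1)])
       (use nbrs_irrefl[OF G, of a] ab in \<open>auto simp: edge_phase_def\<close>)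
  also have "sum ?g (cuts V) = (\<Sum>\<sigma>\<in>cuts V. of_real ((cos \<gamma>)\<^sup>2) * ?D \<sigma>
      + \<i> * of_real (sin \<gamma> * cos \<gamma>) * of_int (\<sigma> b * \<sigma> v)
      + \<i> * of_real (sin \<gamma> * cos \<gamma>) * of_int (\<sigma> a * \<sigma> v) - of_real ((sin \<gamma>)\<^sup>2))"
  proof (rule sum.cong)
    fix \<sigma> assume \<sigma>: "\<sigma> \<in> cuts V"
    show "?g \<sigma> = of_real ((cos \<gamma>)\<^sup>2) * ?D \<sigma>
      + \<i> * of_real (sin \<gamma> * cos \<gamma>) * of_int (\<sigma> b * \<sigma> v)
      + \<i> * of_real (sin \<gamma> * cos \<gamma>) * of_int (\<sigma> a * \<sigma> v) - of_real ((sin \<gamma>)\<^sup>2)"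
      using cuts_values[OF \<sigma> V(1)] cuts_values[OF \<sigma> V(2)] cuts_values[OF \<sigma> V(3)]
      by (auto simp: edge_phase_eq[OF \<sigma> V(1,3)] edge_phase_eq[OF \<sigma> V(2,3)] algebra_simps power2_eq_square)
  qed simp
  also have "\<dots> = - (2 ^ card V * of_real ((sin \<gamma>)\<^sup>2))"
  proof -
    have "(\<Sum>\<sigma>\<in>cuts V. complex_of_int (\<sigma> x * \<sigma> y)) = 0" if "x \<in> V" "x \<noteq> y" for x y
      by (rule sum_cuts_odd[OF that(1)]) (use that in simp)
    then have "(\<Sum>\<sigma>\<in>cuts V. complex_of_int (\<sigma> a * \<sigma> b)) = 0" "(\<Sum>\<sigma>\<in>cuts V. complex_of_int (\<sigma> b * \<sigma> v)) = 0"
        "(\<Sum>\<sigma>\<in>cuts V. complex_of_int (\<sigma> a * \<sigma> v)) = 0"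
      using V ab(1) ne by metis+
    then show ?thesis
      unfolding sum.distrib sum_subtractf sum_distrib_left[symmetric] by (simp add: card_cuts[OF fin])
  qed
  finally have two: "(\<Sum>\<sigma>\<in>cuts V. ?D \<sigma> *
      ((\<Prod>w\<in>nbrs E a - {b}. edge_phase \<gamma> a w \<sigma>) * (\<Prod>w\<in>nbrs E b - {a}. edge_phase \<gamma> b w \<sigma>))) =
      - (2 ^ card V * of_real ((sin \<gamma>)\<^sup>2 * cos \<gamma> ^ (card (nbrs E a) - 1 + (card (nbrs E b) - 1))))"
    using va vb finite_nbrs[OF G] by (simp add: card_Diff_singleton power_add mult_ac)
  have "2 ^ card V * complex_of_real ?lhs = 2 ^ card V * complex_of_real ?rhs"
    unfolding qaoa_correlation_expand[OF G V(1,2) ab(1)] two zero[OF refl] zero[OF insert_commute]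
    by simp
  then show ?thesis by (simp only: mult_cancel_left of_real_eq_iff) simp
qed

section \<open>Expected improvement on a cubic graph\<close>

lemma satisfied_edge: "satisfied \<sigma> {u, v} \<longleftrightarrow> \<sigma> u \<noteq> \<sigma> v"
  by (auto simp: satisfied_def doubleton_eq_iff)

lemma card_satisfied_incident:
  assumes "graph_on V E"
  shows "card {e \<in> E. v \<in> e \<and> satisfied \<sigma> e} = card {w \<in> nbrs E v. \<sigma> v \<noteq> \<sigma> w}"
proof -
  have "{e \<in> E. v \<in> e \<and> satisfied \<sigma> e} = {e \<in> {e \<in> E. v \<in> e}. satisfied \<sigma> e}" by auto
  also have "\<dots> = (\<lambda>w. {v, w}) ` {w \<in> nbrs E v. \<sigma> v \<noteq> \<sigma> w}"
    unfolding incident_edges[OF assms] by (auto simp: satisfied_edge)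
  finally show ?thesis by (simp add: card_image inj_on_edge)
qed

text \<open>No edge has both ends in \<open>V0\<close>, so the edges meeting \<open>V0\<close> are
  partitioned by their end in \<open>V0\<close>. The first summand depends only on spins outside
  \<open>V0\<close> and is untouched by the update.\<close>

lemma cut_size_split:
  assumes G: "graph_on V E" and "V0 \<subseteq> V" and indep: "\<And>v. v \<in> V0 \<Longrightarrow> nbrs E v \<inter> V0 = {}"
  shows "cut_size E \<sigma> = card {e \<in> E. e \<inter> V0 = {} \<and> satisfied \<sigma> e} +
    (\<Sum>v\<in>V0. card {w \<in> nbrs E v. \<sigma> v \<noteq> \<sigma> w})"
proof -
  let ?S = "\<lambda>v. {e \<in> E. v \<in> e \<and> satisfied \<sigma> e}"
  have finE: "finite E" and finV0: "finite V0"
    using graph_on_finite[OF G] finite_subset[OF assms(2)] by auto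
  have disj: "?S u \<inter> ?S v = {}" if "u \<in> V0" "v \<in> V0" "u \<noteq> v" for u v
  proof -
    have "v \<notin> nbrs E u" using indep[OF that(1)] that(2) by auto
    then have "e \<notin> {e \<in> E. v \<in> e}" if "e \<in> {e \<in> E. u \<in> e}" for e
      using that \<open>u \<noteq> v\<close> unfolding incident_edges[OF G] by (auto simp: doubleton_eq_iff nbrs_sym[of u])
    then show ?thesis by blast
  qed
  have "{e \<in> E. satisfied \<sigma> e} = {e \<in> E. e \<inter> V0 = {} \<and> satisfied \<sigma> e} \<union> (\<Union>v\<in>V0. ?S v)"
    by auto
  then have "cut_size E \<sigma> = card {e \<in> E. e \<inter> V0 = {} \<and> satisfied \<sigma> e} + card (\<Union>v\<in>V0. ?S v)"
    unfolding cut_size_def using finE finV0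
    by (simp only:) (rule card_Un_disjoint, auto)
  also have "card (\<Union>v\<in>V0. ?S v) = (\<Sum>v\<in>V0. card (?S v))"
    using finE finV0 disj by (intro card_UN_disjoint) auto
  finally show ?thesis unfolding card_satisfied_incident[OF G] .
qed

text \<open>For spins \<open>s\<close> and \<open>t\<close> the indicator of
  \<open>s \<noteq> t\<close> is \<open>(1 - s * t) / 2\<close>.\<close>

lemma card_differing:
  assumes "finite W" "\<And>w. w \<in> W \<Longrightarrow> \<sigma> w = 1 \<or> \<sigma> w = -1" "s = 1 \<or> s = (-1 :: int)"
  shows "2 * int (card {w \<in> W. s \<noteq> \<sigma> w}) = int (card W) - s * (\<Sum>w\<in>W. \<sigma> w)"
proof -
  have "2 * int (card {w \<in> W. s \<noteq> \<sigma> w}) = (\<Sum>w\<in>W. 2 * of_bool (s \<noteq> \<sigma> w))"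
    using assms(1) by (simp add: sum_distrib_left[symmetric] of_bool_def sum.If_cases Int_def)
  also have "\<dots> = (\<Sum>w\<in>W. 1 - s * \<sigma> w)"
  proof (rule sum.cong)
    fix w assume "w \<in> W"
    from assms(2)[OF this] assms(3) show "2 * of_bool (s \<noteq> \<sigma> w) = 1 - s * \<sigma> w"
      by (elim disjE) simp_all
  qed simp
  finally show ?thesis by (simp add: sum_subtractf sum_distrib_left)
qed

section \<open>The improvement as a sum of local gains\<close>

definition gain :: "'a set set \<Rightarrow> 'a \<Rightarrow> ('a \<Rightarrow> int) \<Rightarrow> int" where
  "gain E v \<sigma> = max 0 (\<sigma> v * (\<Sum>w\<in>nbrs E v. \<sigma> w))"

text \<open>Let \<open>S\<close> be the sum of the spins around \<open>v\<close> and
  \<open>d\<close> its degree. The update raises the number of satisfied edges at \<open>v\<close>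
  from \<open>(d - \<sigma> v * S) / 2\<close> to \<open>(d + \<bar>S\<bar>) / 2\<close>, a
  difference of \<open>max 0 (\<sigma> v * S)\<close>.\<close>

lemma improvement_eq_gain:
  assumes G: "graph_on V E" and V0: "V0 \<subseteq> V" and indep: "\<And>v. v \<in> V0 \<Longrightarrow> nbrs E v \<inter> V0 = {}"
    and \<sigma>: "\<sigma> \<in> cuts V"
  shows "improvement E V0 \<sigma> = (\<Sum>v\<in>V0. of_int (gain E v \<sigma>))"
proof -
  let ?\<tau> = "local_update E V0 \<sigma>"
  have local: "int (card {w \<in> nbrs E v. ?\<tau> v \<noteq> ?\<tau> w}) = int (card {w \<in> nbrs E v. \<sigma> v \<noteq> \<sigma> w}) + gain E v \<sigma>"
    if v: "v \<in> V0" for v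
  proof -
    let ?f = "\<lambda>s. card {e \<in> E. v \<in> e \<and> satisfied (\<sigma>(v := s)) e}"
    have f: "?f s = card {w \<in> nbrs E v. s \<noteq> \<sigma> w}" for s
      unfolding card_satisfied_incident[OF G]
      by (rule arg_cong[of _ _ card]) (use nbrs_irrefl[OF G, of v] in auto)
    \<comment> \<open>A strict bound on the values at both candidates, from which
      \<open>arg_max\<close> is known to attain the maximum.\<close>
    have bound: "\<forall>s. s \<in> {-1, 1} \<longrightarrow> ?f s < Suc (card E)"
      using graph_on_finite(2)[OF G] by (auto intro!: le_imp_less_Suc card_mono)
    have \<tau>v: "?\<tau> v = arg_max ?f (\<lambda>s. s \<in> {-1, 1})"
      using v by (simp add: local_update_def)
    have max: "?\<tau> v \<in> {-1, 1}" "\<forall>s. s \<in> {-1, 1} \<longrightarrow> ?f s \<le> ?f (?\<tau> v)"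
      using arg_max_nat_lemma[OF _ bound, of 1] unfolding \<tau>v by auto
    have same: "{w \<in> nbrs E v. ?\<tau> v \<noteq> ?\<tau> w} = {w \<in> nbrs E v. ?\<tau> v \<noteq> \<sigma> w}"
      using indep[OF v] by (auto simp: local_update_def)
    have count: "2 * int (card {w \<in> nbrs E v. s \<noteq> \<sigma> w}) = int (card (nbrs E v)) - s * (\<Sum>w\<in>nbrs E v. \<sigma> w)"
      if "s = 1 \<or> s = -1" for s
      using that nbrs_subset[OF G, of v] cuts_values[OF \<sigma>]
      by (intro card_differing finite_nbrs[OF G]) auto
    have \<sigma>v: "\<sigma> v = 1 \<or> \<sigma> v = -1" using cuts_values[OF \<sigma>] v V0 by auto
    have \<tau>1: "?\<tau> v = 1 \<or> ?\<tau> v = -1" using max(1) by auto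
    have "int (?f 1) \<le> int (?f (?\<tau> v))" "int (?f (-1)) \<le> int (?f (?\<tau> v))" using max(2) by auto
    then show ?thesis
      using count[OF \<sigma>v] count[OF \<tau>1] count[of 1] count[of "-1"] \<sigma>v \<tau>1
      unfolding f same gain_def by (elim disjE) (simp_all add: max_def split: if_splits)
  qed
  have rest: "{e \<in> E. e \<inter> V0 = {} \<and> satisfied ?\<tau> e} = {e \<in> E. e \<inter> V0 = {} \<and> satisfied \<sigma> e}"
    unfolding satisfied_def by (auto simp: local_update_def)
  have split: "cut_size E \<rho> = card {e \<in> E. e \<inter> V0 = {} \<and> satisfied \<rho> e} +
      (\<Sum>v\<in>V0. card {w \<in> nbrs E v. \<rho> v \<noteq> \<rho> w})" for \<rho>
    by (rule cut_size_split[OF G V0]) (rule indep)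
  have "int (cut_size E ?\<tau>) = int (cut_size E \<sigma>) + (\<Sum>v\<in>V0. gain E v \<sigma>)"
    unfolding split rest of_nat_add of_nat_sum
    by (simp add: local sum.distrib)
  then have "real_of_int (int (cut_size E ?\<tau>)) = real_of_int (int (cut_size E \<sigma>) + (\<Sum>v\<in>V0. gain E v \<sigma>))"
    by (simp only:)
  then show ?thesis by (simp add: improvement_def)
qed

text \<open>The number \<open>t = \<sigma> v * (\<sigma> a + \<sigma> b + \<sigma> c)\<close> is one
  of -3, -1, 1, 3, where \<open>max 0 t\<close> agrees with \<open>(t^2 + 4 t + 3) / 8\<close>.
  Since \<open>t^2\<close> is 3 plus twice the three products of neighbouring spins, only two-point
  correlations remain.\<close>

lemma gain_polynomial:
  assumes \<sigma>: "\<sigma> \<in> cuts V" and "v \<in> V" "{a, b, c} \<subseteq> V" "nbrs E v = {a, b, c}" "a \<noteq> b" "a \<noteq> c" "b \<noteq> c"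
  shows "real_of_int (gain E v \<sigma>) = 3 / 4
    + 1 / 2 * (of_int (\<sigma> v * \<sigma> a) + of_int (\<sigma> v * \<sigma> b) + of_int (\<sigma> v * \<sigma> c))
    + 1 / 4 * (of_int (\<sigma> a * \<sigma> b) + of_int (\<sigma> a * \<sigma> c) + of_int (\<sigma> b * \<sigma> c))"
  using cuts_values[OF \<sigma> assms(2)] cuts_values[OF \<sigma>, of a] cuts_values[OF \<sigma>, of b]
    cuts_values[OF \<sigma>, of c] assms(3-)
  by (simp add: gain_def) (elim disjE; simp)

text \<open>A triangle \<open>v a b\<close> is recorded with \<open>w = a\<close>, a 4-cycle \<open>v a w b\<close> with \<open>w\<close> opposite to \<open>v\<close>.\<close>

definition short_cycles :: "'a set set \<Rightarrow> ('a \<times> 'a \<times> 'a \<times> 'a) set" where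
  "short_cycles E = {(v, a, w, b). a \<in> nbrs E v \<and> b \<in> nbrs E v \<and> a \<noteq> b \<and> w \<noteq> v \<and> w \<in> nbrs E b \<and>
     (w = a \<or> w \<in> nbrs E a)}"

lemma short_cycles_subset:
  assumes "graph_on V E"
  shows "short_cycles E \<subseteq> V \<times> V \<times> V \<times> V"
  using nbrs_subset[OF assms] nbrs_vertex[OF assms] by (fastforce simp: short_cycles_def)

lemma nbrs_no_short_cycle:
  assumes G: "graph_on V E" and good: "v \<notin> fst ` short_cycles E"
    and a: "a \<in> nbrs E v" and b: "b \<in> nbrs E v" and ab: "a \<noteq> b"
  shows "b \<notin> nbrs E a" "nbrs E a \<inter> nbrs E b = {v}"
proof -
  have none: "(v, x) \<notin> short_cycles E" for x using good by force
  have va: "a \<noteq> v" using nbrs_irrefl[OF G] a by auto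
  show "b \<notin> nbrs E a"
    using none[of "(a, a, b)"] a b ab va by (auto simp: short_cycles_def nbrs_sym)
  show "nbrs E a \<inter> nbrs E b = {v}"
    using none[of "(a, w, b)" for w] a b ab by (auto simp: short_cycles_def nbrs_sym)
qed

lemma measurement_expectation_add:
  "measurement_expectation V \<psi> (\<lambda>\<sigma>. f \<sigma> + g \<sigma>) = measurement_expectation V \<psi> f + measurement_expectation V \<psi> g"
  by (simp add: measurement_expectation_def sum.distrib algebra_simps)

lemma measurement_expectation_mult:
  "measurement_expectation V \<psi> (\<lambda>\<sigma>. c * f \<sigma>) = c * measurement_expectation V \<psi> f"
  by (simp add: measurement_expectation_def sum_distrib_left algebra_simps)

lemma measurement_expectation_sum:
  "measurement_expectation V \<psi> (\<lambda>\<sigma>. \<Sum>i\<in>I. f i \<sigma>) = (\<Sum>i\<in>I. measurement_expectation V \<psi> (f i))"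
  unfolding measurement_expectation_def sum_distrib_left by (rule sum.swap)

lemma measurement_expectation_cong:
  "(\<And>\<sigma>. \<sigma> \<in> cuts V \<Longrightarrow> f \<sigma> = g \<sigma>) \<Longrightarrow> measurement_expectation V \<psi> f = measurement_expectation V \<psi> g"
  by (simp add: measurement_expectation_def)

lemma measurement_expectation_mono:
  "(\<And>\<sigma>. \<sigma> \<in> cuts V \<Longrightarrow> f \<sigma> \<le> g \<sigma>) \<Longrightarrow> measurement_expectation V \<psi> f \<le> measurement_expectation V \<psi> g"
  unfolding measurement_expectation_def by (intro sum_mono mult_left_mono) auto

definition cubic_rate :: "real \<Rightarrow> real \<Rightarrow> real" where
  "cubic_rate \<beta> \<gamma> = 3 / 4 * (1 + 2 * sin (2 * \<beta>) * (cos \<gamma>)\<^sup>2 * sin \<gamma>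
     + (sin \<beta>)\<^sup>2 * (cos \<gamma>) ^ 4 * (sin \<gamma>)\<^sup>2)"

text \<open>The coefficients add up to \<open>3/4 + 3/2 + 3/4\<close>. As the gain at a vertex of
  degree 3 lies between 0 and 3, a vertex on a short cycle deviates by at most 6.\<close>

lemma abs_cubic_rate: "\<bar>cubic_rate \<beta> \<gamma>\<bar> \<le> 3"
proof -
  have unit: "\<bar>x * y\<bar> \<le> 1" if "\<bar>x\<bar> \<le> 1" "\<bar>y\<bar> \<le> 1" for x y :: real
    using mult_mono[OF that] by (simp add: abs_mult)
  have sq: "\<bar>x ^ k\<bar> \<le> 1" if "\<bar>x\<bar> \<le> 1" for x :: real and k
    using that by (simp add: power_abs power_le_one)
  have "\<bar>sin (2 * \<beta>) * (cos \<gamma>)\<^sup>2 * sin \<gamma>\<bar> \<le> 1"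
    by (intro unit sq) auto
  moreover have "\<bar>(sin \<beta>)\<^sup>2 * (cos \<gamma>) ^ 4 * (sin \<gamma>)\<^sup>2\<bar> \<le> 1"
    by (intro unit sq) auto
  moreover have "cubic_rate \<beta> \<gamma> = 3 / 4 + 3 / 2 * (sin (2 * \<beta>) * (cos \<gamma>)\<^sup>2 * sin \<gamma>)
      + 3 / 4 * ((sin \<beta>)\<^sup>2 * (cos \<gamma>) ^ 4 * (sin \<gamma>)\<^sup>2)"
    by (simp add: cubic_rate_def algebra_simps)
  ultimately show ?thesis by linarith
qed

text \<open>Three pairs at distance one have weight \<open>1/2\<close> and three at distance two
  have weight \<open>1/4\<close>. Degree 3 leaves two further edges at each end, whence the
  exponents 2 and 4 of the cosine.\<close>

lemma expected_gain:
  assumes G: "graph_on V E" and cubic: "\<And>v. v \<in> V \<Longrightarrow> card (nbrs E v) = 3" and v: "v \<in> V"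
    and good: "v \<notin> fst ` short_cycles E"
  shows "measurement_expectation V (qaoa_state V E \<beta> \<gamma>) (\<lambda>\<sigma>. of_int (gain E v \<sigma>)) = cubic_rate \<beta> \<gamma>"
proof -
  let ?M = "measurement_expectation V (qaoa_state V E \<beta> \<gamma>)"
  obtain a b c where N: "nbrs E v = {a, b, c}" "a \<noteq> b" "a \<noteq> c" "b \<noteq> c"
    using cubic[OF v] by (auto simp: card_3_iff)
  have abc: "{a, b, c} \<subseteq> V" using nbrs_subset[OF G, of v] N by simp
  have adj: "?M (\<lambda>\<sigma>. of_int (\<sigma> v * \<sigma> x)) = sin (2 * \<beta>) * sin \<gamma> * (cos \<gamma>)\<^sup>2" if x: "x \<in> nbrs E v" for x
  proof -
    have xV: "x \<in> V" using x nbrs_subset[OF G] by auto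
    have "nbrs E v \<inter> nbrs E x = {}"
      using nbrs_no_short_cycle(1)[OF G good x] nbrs_irrefl[OF G, of x] by blast
    from qaoa_correlation_adjacent[OF G x this] show ?thesis
      by (simp add: cubic v xV sin_double)
  qed
  have dist2: "?M (\<lambda>\<sigma>. of_int (\<sigma> x * \<sigma> y)) = (sin \<beta>)\<^sup>2 * (sin \<gamma>)\<^sup>2 * (cos \<gamma>) ^ 4"
    if xy: "x \<in> nbrs E v" "y \<in> nbrs E v" "x \<noteq> y" for x y
  proof -
    have xV: "x \<in> V" "y \<in> V" using xy nbrs_subset[OF G] by auto
    from qaoa_correlation_distance_two[OF G xy(3) nbrs_no_short_cycle[OF G good xy]]
    show ?thesis by (simp add: cubic xV)
  qed
  have "?M (\<lambda>\<sigma>. of_int (gain E v \<sigma>)) = ?M (\<lambda>\<sigma>. 3 / 4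
    + 1 / 2 * (of_int (\<sigma> v * \<sigma> a) + of_int (\<sigma> v * \<sigma> b) + of_int (\<sigma> v * \<sigma> c))
    + 1 / 4 * (of_int (\<sigma> a * \<sigma> b) + of_int (\<sigma> a * \<sigma> c) + of_int (\<sigma> b * \<sigma> c)))"
    by (rule measurement_expectation_cong) (rule gain_polynomial[OF _ v abc N])
  also have "\<dots> = cubic_rate \<beta> \<gamma>"
    unfolding measurement_expectation_add measurement_expectation_mult qaoa_norm[OF graph_on_finite(1)[OF G]]
    using adj[of a] adj[of b] adj[of c] dist2[of a b] dist2[of a c] dist2[of b c] N
    by (simp add: cubic_rate_def algebra_simps del: of_int_mult)
  finally show ?thesis .
qed

text \<open>Vertices off the short cycles contribute exactly the rate, and the others number at most
  as many as the recorded cycles. The bound is uniform in \<open>V0\<close>.\<close>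

lemma expected_improvement_approx:
  assumes G: "graph_on V E" and cubic: "\<And>v. v \<in> V \<Longrightarrow> card (nbrs E v) = 3"
    and V0: "V0 \<subseteq> V" and indep: "\<And>v. v \<in> V0 \<Longrightarrow> nbrs E v \<inter> V0 = {}"
  shows "\<bar>expected_improvement V E \<beta> \<gamma> V0 - cubic_rate \<beta> \<gamma> * real (card V0)\<bar> \<le> 6 * real (card (short_cycles E))"
proof -
  let ?M = "measurement_expectation V (qaoa_state V E \<beta> \<gamma>)" and ?B = "fst ` short_cycles E"
  let ?d = "\<lambda>v. ?M (\<lambda>\<sigma>. of_int (gain E v \<sigma>)) - cubic_rate \<beta> \<gamma>"
  have finV: "finite V" by (rule graph_on_finite(1)[OF G])
  have finV0: "finite V0" by (rule finite_subset[OF V0 finV])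
  have finB: "finite (short_cycles E)"
    by (rule finite_subset[OF short_cycles_subset[OF G]]) (intro finite_cartesian_product finV)
  have d: "\<bar>?d v\<bar> \<le> 6 * of_bool (v \<in> ?B)" if v: "v \<in> V0" for v
  proof (cases "v \<in> ?B")
    case True
    have "0 \<le> gain E v \<sigma> \<and> gain E v \<sigma> \<le> 3" if \<sigma>: "\<sigma> \<in> cuts V" for \<sigma>
    proof -
      have "\<bar>\<sigma> w\<bar> \<le> 1" if "w \<in> nbrs E v" for w
      proof -
        have "w \<in> V" using nbrs_subset[OF G, of v] that by blast
        from cuts_values[OF \<sigma> this] show ?thesis by (elim disjE) simp_all
      qed
      then have "\<bar>\<Sum>w\<in>nbrs E v. \<sigma> w\<bar> \<le> (\<Sum>w\<in>nbrs E v. 1)"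
        by (intro order.trans[OF sum_abs] sum_mono)
      then have "\<bar>\<Sum>w\<in>nbrs E v. \<sigma> w\<bar> \<le> 3" using cubic v V0 by auto
      moreover have "\<sigma> v = 1 \<or> \<sigma> v = -1" using cuts_values[OF \<sigma>] v V0 by auto
      ultimately show ?thesis by (auto simp: gain_def)
    qed
    then have "?M (\<lambda>_. 0) \<le> ?M (\<lambda>\<sigma>. of_int (gain E v \<sigma>))" "?M (\<lambda>\<sigma>. of_int (gain E v \<sigma>)) \<le> ?M (\<lambda>_. 3)"
      by (auto intro!: measurement_expectation_mono)
    then show ?thesis
      using abs_cubic_rate[of \<beta> \<gamma>] True by (simp add: qaoa_norm[OF finV] abs_le_iff)
  next
    case False
    then show ?thesis using expected_gain[OF G cubic _ False] v V0 by auto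
  qed
  have "expected_improvement V E \<beta> \<gamma> V0 = (\<Sum>v\<in>V0. ?M (\<lambda>\<sigma>. of_int (gain E v \<sigma>)))"
    unfolding expected_improvement_def measurement_expectation_sum[symmetric]
    by (rule measurement_expectation_cong) (rule improvement_eq_gain[OF G V0 indep])
  then have "\<bar>expected_improvement V E \<beta> \<gamma> V0 - cubic_rate \<beta> \<gamma> * real (card V0)\<bar> = \<bar>\<Sum>v\<in>V0. ?d v\<bar>"
    by (simp add: sum_subtractf mult.commute)
  also have "\<dots> \<le> (\<Sum>v\<in>V0. 6 * of_bool (v \<in> ?B))"
    by (rule order.trans[OF sum_abs sum_mono]) (rule d)
  also have "\<dots> = 6 * real (card (V0 \<inter> ?B))"
    using finV0 by (simp add: sum_distrib_left[symmetric] of_bool_def sum.If_cases Int_def)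
  also have "\<dots> \<le> 6 * real (card (short_cycles E))"
    using card_mono[OF finite_imageI[OF finB], of "V0 \<inter> ?B" fst] card_image_le[OF finB, of fst] by simp
  finally show ?thesis .
qed

section \<open>Short cycles in random cubic graphs\<close>

lemma regular_graphs_iff:
  "E \<in> regular_graphs d n \<longleftrightarrow> graph_on {..<n} E \<and> (\<forall>v<n. card (nbrs E v) = d)"
  using card_incident_edges[of "{..<n}" E] by (auto simp: regular_graphs_def graph_on_def)

lemma finite_regular_graphs: "finite (regular_graphs d n)"
  by (rule finite_subset[of _ "Pow (Pow {..<n})"]) (auto simp: regular_graphs_def)

section \<open>Switchings and the number of short cycles\<close>

definition switch :: "'a set set \<Rightarrow> 'a \<Rightarrow> 'a \<Rightarrow> 'a \<Rightarrow> 'a \<Rightarrow> 'a set set" where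
  "switch E v a x y = (E - {{v, a}, {x, y}}) \<union> {{v, x}, {a, y}}"

text \<open>Both old edges are present, and the new edges \<open>{v, x}\<close> and
  \<open>{a, y}\<close> are neither loops nor already present, so the switched graph is simple with
  unchanged degrees.\<close>

definition switchable :: "'a set set \<Rightarrow> 'a \<Rightarrow> 'a \<Rightarrow> 'a \<Rightarrow> 'a \<Rightarrow> bool" where
  "switchable E v a x y \<longleftrightarrow> a \<in> nbrs E v \<and> y \<in> nbrs E x \<and> x \<notin> {v, a} \<and> y \<notin> {v, a} \<and>
     x \<notin> nbrs E v \<and> y \<notin> nbrs E a"

text \<open>A switching is undone by exchanging the roles of \<open>a\<close> and \<open>x\<close>.
  This makes the map in the double count injective.\<close>

lemma switch_switch:
  assumes "switchable E v a x y"
  shows "switch (switch E v a x y) v x a y = E"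
  using assms by (auto simp: switchable_def switch_def nbrs_def doubleton_eq_iff insert_commute)

lemma switch_regular:
  assumes E: "E \<in> regular_graphs d n" and sw: "switchable E v a x y"
  shows "switch E v a x y \<in> regular_graphs d n"
proof -
  let ?E = "switch E v a x y"
  have G: "graph_on {..<n} E" and deg: "\<And>u. u < n \<Longrightarrow> card (nbrs E u) = d"
    using E by (auto simp: regular_graphs_iff)
  have ne: "a \<noteq> v" "x \<noteq> v" "x \<noteq> a" "y \<noteq> v" "y \<noteq> a" "y \<noteq> x"
    using sw nbrs_irrefl[OF G] by (auto simp: switchable_def)
  have lt: "v < n" "a < n" "x < n" "y < n"
    using sw nbrs_vertex[OF G] nbrs_subset[OF G] by (auto simp: switchable_def)
  have mem: "a \<in> nbrs E v" "v \<in> nbrs E a" "y \<in> nbrs E x" "x \<in> nbrs E y"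
    "x \<notin> nbrs E v" "v \<notin> nbrs E x" "y \<notin> nbrs E a" "a \<notin> nbrs E y"
    using sw by (auto simp: switchable_def nbrs_sym)
  have G': "graph_on {..<n} ?E"
    using G ne lt by (auto simp: graph_on_def switch_def card_insert_if)
  have eq: "nbrs ?E v = insert x (nbrs E v - {a})" "nbrs ?E a = insert y (nbrs E a - {v})"
    "nbrs ?E x = insert v (nbrs E x - {y})" "nbrs ?E y = insert a (nbrs E y - {x})"
    using ne by (auto simp: nbrs_def switch_def doubleton_eq_iff)
  have other: "nbrs ?E u = nbrs E u" if "u \<notin> {v, a, x, y}" for u
    using that by (auto simp: nbrs_def switch_def doubleton_eq_iff)
  have swap: "card (insert p (S - {q})) = card S" if "finite S" "p \<notin> S" "q \<in> S" for S :: "nat set" and p q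
  proof -
    have "card S > 0" using that by (auto simp: card_gt_0_iff)
    then show ?thesis using that by (simp add: card_insert_if card_Diff_singleton)
  qed
  have "card (nbrs ?E u) = card (nbrs E u)" for u
    using mem swap[OF finite_nbrs[OF G]] eq other[of u] by (cases "u \<in> {v, a, x, y}") auto
  then show ?thesis using G' deg by (simp add: regular_graphs_iff)
qed

lemma card_Sigma_le:
  assumes "finite A" "\<And>a. a \<in> A \<Longrightarrow> finite (B a)" "\<And>a. a \<in> A \<Longrightarrow> card (B a) \<le> k"
  shows "card (Sigma A B) \<le> card A * k"
proof -
  have "card (Sigma A B) = (\<Sum>a\<in>A. card (B a))" using assms by (intro card_SigmaI) auto
  also have "\<dots> \<le> card A * k" using sum_bounded_above[of A "\<lambda>a. card (B a)" k] assms(3) by simp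
  finally show ?thesis .
qed

text \<open>Of the \<open>3 * n\<close> oriented edges at most \<open>3 * 10\<close> start in
  \<open>S\<close> and as many end there, which leaves \<open>3 * n - 60\<close>.\<close>

lemma card_switch_partners:
  assumes E: "E \<in> regular_graphs 3 n" and S: "S \<subseteq> {..<n}" "card S \<le> 10"
  shows "3 * n - 60 \<le> card {(x, y). y \<in> nbrs E x \<and> x \<notin> S \<and> y \<notin> S}"
proof -
  have G: "graph_on {..<n} E" and deg: "\<And>u. u < n \<Longrightarrow> card (nbrs E u) = 3"
    using E by (auto simp: regular_graphs_iff)
  let ?A = "SIGMA x:{..<n}. nbrs E x" and ?B = "SIGMA x:S. nbrs E x"
  let ?P = "{(x, y). y \<in> nbrs E x \<and> x \<notin> S \<and> y \<notin> S}"
  have finS: "finite S" using S(1) finite_subset by blast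
  have finP: "finite ?P"
    by (rule finite_subset[of _ "{..<n} \<times> {..<n}"])
       (use nbrs_vertex[OF G] nbrs_subset[OF G] in auto)
  have finB: "finite ?B" using finS finite_nbrs[OF G] by auto
  have "card ?A = 3 * n" using finite_nbrs[OF G] deg by (subst card_SigmaI) auto
  moreover have "card ?B \<le> card S * 3"
    by (rule card_Sigma_le[OF finS finite_nbrs[OF G]]) (use deg S in auto)
  moreover have "?A \<subseteq> ?P \<union> (?B \<union> prod.swap ` ?B)"
    by (auto simp: nbrs_sym image_iff)
  then have "card ?A \<le> card (?P \<union> (?B \<union> prod.swap ` ?B))"
    using finP finB by (intro card_mono) auto
  moreover have "\<dots> \<le> card ?P + (card ?B + card (prod.swap ` ?B))"
    by (intro order.trans[OF card_Un_le] add_mono order.refl card_Un_le)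
  moreover have "card (prod.swap ` ?B) \<le> card ?B" by (rule card_image_le[OF finB])
  ultimately show ?thesis using S(2) by linarith
qed

text \<open>The switching trades a short cycle through the edge \<open>{v, a}\<close> and a far away edge \<open>{x, y}\<close>
  for the path of length two or three that remains of the cycle, together with one further
  neighbour at each of its ends. There are about \<open>3 n\<close> choices of the far away edge, but only
  \<open>O(n)\<close> such configurations in all, so that there are \<open>O(1)\<close> short cycles on average.\<close>

lemma sum_card_short_cycles:
  assumes n: "30 \<le> n"
  shows "(\<Sum>E\<in>regular_graphs 3 n. card (short_cycles E)) \<le> 324 * card (regular_graphs 3 n)"
proof -
  let ?R = "regular_graphs 3 n"
  \<comment> \<open>Avoiding the cycle keeps its other edges intact, and avoiding the neighbours of
    \<open>v\<close> and \<open>a\<close> makes the switching admissible. The size is at most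
    \<open>4 + 3 + 3 = 10\<close>.\<close>
  define S where "S E v a w b = {v, a, w, b} \<union> nbrs E v \<union> nbrs E a" for E :: "nat set set" and v a w b
  define P where "P E = (\<lambda>(v, a, w, b). {(x, y). y \<in> nbrs E x \<and> x \<notin> S E v a w b \<and> y \<notin> S E v a w b})" for E
  define X where "X = (SIGMA E:?R. SIGMA t:short_cycles E. P E t)"
  \<comment> \<open>The path \<open>v b w a\<close> left over from the cycle, with
    \<open>a = w\<close> for a triangle, and the new neighbours \<open>x\<close> of \<open>v\<close>
    and \<open>y\<close> of \<open>a\<close>. The choices after \<open>v\<close> number at most
    \<open>3 * 3 * 4 * 3 * 3 = 324\<close>.\<close>
  define T where "T E = (SIGMA v:{..<n}. SIGMA b:nbrs E v. SIGMA w:nbrs E b. SIGMA a:insert w (nbrs E w).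
    nbrs E v \<times> nbrs E a)" for E :: "nat set set"
  define Y where "Y = Sigma ?R T"
  \<comment> \<open>All six vertices are kept alongside the switched graph, so the original graph
    can be recovered by the reverse switching.\<close>
  define F where "F = (\<lambda>(E, (v, a, w, b), (x, y)). (switch E v a x y, v, b :: nat, w :: nat, a, x, y :: nat))"
  have G: "graph_on {..<n} E" and deg: "\<And>u. u < n \<Longrightarrow> card (nbrs E u) = 3" if "E \<in> ?R" for E
    using that by (auto simp: regular_graphs_iff)
  have fin: "finite ?R" by (rule finite_regular_graphs)
  have finsc: "finite (short_cycles E)" if "E \<in> ?R" for E
    by (rule finite_subset[OF short_cycles_subset[OF G[OF that]]]) simp
  have finP: "finite (P E t)" if E: "E \<in> ?R" for E t
    by (rule finite_subset[of _ "{..<n} \<times> {..<n}"])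
       (use nbrs_vertex[OF G[OF E]] nbrs_subset[OF G[OF E]] in \<open>auto simp: P_def split: prod.splits\<close>)
  have cardP: "3 * n - 60 \<le> card (P E t)" if E: "E \<in> ?R" and t: "t \<in> short_cycles E" for E t
  proof -
    obtain v a w b where [simp]: "t = (v, a, w, b)" by (cases t)
    have lt: "v < n" "a < n" "w < n" "b < n"
      using short_cycles_subset[OF G[OF E]] t by auto
    have "card (S E v a w b) \<le> card {v, a, w, b} + card (nbrs E v) + card (nbrs E a)"
      unfolding S_def by (intro order.trans[OF card_Un_le] add_mono card_Un_le order.refl)
    moreover have "card {v, a, w, b} \<le> 4"
      using card_length[of "[v, a, w, b]"] by simp
    ultimately have "card (S E v a w b) \<le> 10" using deg[OF E] lt by simp
    moreover have "S E v a w b \<subseteq> {..<n}"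
      using lt nbrs_subset[OF G[OF E]] by (auto simp: S_def)
    ultimately show ?thesis using card_switch_partners[OF E] by (simp add: P_def)
  qed
  have finT: "finite (T E)" if "E \<in> ?R" for E
    unfolding T_def using finite_nbrs[OF G[OF that]] by (intro finite_SigmaI) auto
  have cardT: "card (T E) \<le> 324 * n" if E: "E \<in> ?R" for E
  proof -
    note fn = finite_nbrs[OF G[OF E]]
    have d: "card (nbrs E u) = 3" if "u \<in> nbrs E u'" for u u'
      using that nbrs_subset[OF G[OF E]] deg[OF E] by auto
    have 1: "card (SIGMA a:insert w (nbrs E w). nbrs E v \<times> nbrs E a) \<le> 36"
      if "v < n" "b \<in> nbrs E v" "w \<in> nbrs E b" for v b w
    proof -
      have "card (SIGMA a:insert w (nbrs E w). nbrs E v \<times> nbrs E a) \<le> card (insert w (nbrs E w)) * 9"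
      proof (rule card_Sigma_le)
        fix a assume "a \<in> insert w (nbrs E w)"
        then have "card (nbrs E a) = 3" using d that(3) by auto
        then show "card (nbrs E v \<times> nbrs E a) \<le> 9" using deg[OF E that(1)] by (simp add: card_cartesian_product)
      qed (use fn in auto)
      also have "\<dots> \<le> 4 * 9" using d[OF that(3)] fn[of w] by (simp add: card_insert_if)
      finally show ?thesis by simp
    qed
    have 2: "card (SIGMA w:nbrs E b. SIGMA a:insert w (nbrs E w). nbrs E v \<times> nbrs E a) \<le> 108"
      if "v < n" "b \<in> nbrs E v" for v b
    proof -
      have "card (SIGMA w:nbrs E b. SIGMA a:insert w (nbrs E w). nbrs E v \<times> nbrs E a) \<le> card (nbrs E b) * 36"
        by (rule card_Sigma_le) (use fn 1[OF that] in auto)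
      then show ?thesis using d[OF that(2)] by simp
    qed
    have 3: "card (SIGMA b:nbrs E v. SIGMA w:nbrs E b. SIGMA a:insert w (nbrs E w). nbrs E v \<times> nbrs E a) \<le> 324"
      if "v < n" for v
    proof -
      have "card (SIGMA b:nbrs E v. SIGMA w:nbrs E b. SIGMA a:insert w (nbrs E w). nbrs E v \<times> nbrs E a) \<le>
          card (nbrs E v) * 108"
        by (rule card_Sigma_le) (use fn 2[OF that] in auto)
      then show ?thesis using deg[OF E that] by simp
    qed
    have "card (T E) \<le> card {..<n} * 324"
      unfolding T_def by (rule card_Sigma_le) (use fn 3 in auto)
    then show ?thesis by simp
  qed
  have sw: "switchable E v a x y"
    if "E \<in> ?R" "(v, a, w, b) \<in> short_cycles E" "(x, y) \<in> P E (v, a, w, b)" for E v a w b x y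
    using that by (auto simp: switchable_def short_cycles_def P_def S_def)
  have "inj_on F X"
  proof (rule inj_on_inverseI)
    fix z assume z: "z \<in> X"
    obtain E v a w b x y where zeq: "z = (E, (v, a, w, b), (x, y))" by (metis surj_pair)
    show "(\<lambda>(E', v, b, w, a, x, y). (switch E' v x a y, (v, a, w, b), (x, y))) (F z) = z"
      using z sw[of E v a w b x y] switch_switch[of E v a x y] by (auto simp: zeq F_def X_def)
  qed
  moreover have "F ` X \<subseteq> Y"
  proof (rule image_subsetI)
    fix z assume z: "z \<in> X"
    obtain E v a w b x y where zeq: "z = (E, (v, a, w, b), (x, y))" by (metis surj_pair)
    have E: "E \<in> ?R" and t: "(v, a, w, b) \<in> short_cycles E" and xy: "(x, y) \<in> P E (v, a, w, b)"
      using z by (auto simp: zeq X_def)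
    have ne: "v \<noteq> a" "b \<noteq> v" "w \<noteq> b" using t nbrs_irrefl[OF G[OF E]] by (auto simp: short_cycles_def)
    have "v < n" using t short_cycles_subset[OF G[OF E]] by auto
    moreover have "b \<in> nbrs (switch E v a x y) v" "w \<in> nbrs (switch E v a x y) b"
      "a \<in> insert w (nbrs (switch E v a x y) w)" "x \<in> nbrs (switch E v a x y) v" "y \<in> nbrs (switch E v a x y) a"
      using t xy ne by (auto simp: short_cycles_def P_def S_def nbrs_def switch_def doubleton_eq_iff insert_commute)
    ultimately show "F z \<in> Y"
      using switch_regular[OF E sw[OF E t xy]] by (auto simp: zeq F_def Y_def T_def)
  qed
  moreover have "finite Y" unfolding Y_def using fin finT by auto
  ultimately have "card X \<le> card Y" by (rule card_inj_on_le)
  moreover have "card Y \<le> card ?R * (324 * n)"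
    unfolding Y_def using fin finT cardT by (rule card_Sigma_le)
  moreover have "n * (\<Sum>E\<in>?R. card (short_cycles E)) \<le> card X"
  proof -
    have "n * (\<Sum>E\<in>?R. card (short_cycles E)) \<le> (\<Sum>E\<in>?R. \<Sum>t\<in>short_cycles E. card (P E t))"
      unfolding sum_distrib_left
    proof (rule sum_mono)
      fix E assume E: "E \<in> ?R"
      \<comment> \<open>For \<open>30 \<le> n\<close> each short cycle has at least
        \<open>3 * n - 60 \<ge> n\<close> partner edges.\<close>
      have "(\<Sum>t\<in>short_cycles E. n) \<le> (\<Sum>t\<in>short_cycles E. card (P E t))"
        using cardP[OF E] n by (intro sum_mono) (fastforce intro: order.trans)
      then show "n * card (short_cycles E) \<le> (\<Sum>t\<in>short_cycles E. card (P E t))" by (simp add: mult.commute)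
    qed
    also have "\<dots> = card X"
      unfolding X_def using fin finsc finP by (subst card_SigmaI) (auto intro!: sum.cong card_SigmaI[symmetric])
    finally show ?thesis .
  qed
  ultimately have "n * (\<Sum>E\<in>?R. card (short_cycles E)) \<le> card ?R * (324 * n)"
    by (meson order.trans)
  also have "\<dots> = n * (324 * card ?R)" by simp
  finally have "n * (\<Sum>E\<in>?R. card (short_cycles E)) \<le> n * (324 * card ?R)" .
  then show ?thesis using n by simp
qed

section \<open>Existence of cubic graphs\<close>

lemma regular_graphs_add_K4:
  assumes E: "E \<in> regular_graphs 3 n"
  shows "E \<union> {{n, n+1}, {n, n+2}, {n, n+3}, {n+1, n+2}, {n+1, n+3}, {n+2, n+3}} \<in> regular_graphs 3 (n + 4)"
    (is "?E \<in> _")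
proof -
  have G: "graph_on {..<n} E" and deg: "\<And>u. u < n \<Longrightarrow> card (nbrs E u) = 3"
    using E by (auto simp: regular_graphs_iff)
  have out: "{u, w} \<notin> E" if "\<not> (u < n \<and> w < n)" for u w
    using G that by (auto simp: graph_on_def)
  have old: "nbrs ?E u = nbrs E u" if "u < n" for u
    using that by (auto simp: nbrs_def doubleton_eq_iff)
  have new: "nbrs ?E n = {n+1, n+2, n+3}" "nbrs ?E (n+1) = {n, n+2, n+3}"
    "nbrs ?E (n+2) = {n, n+1, n+3}" "nbrs ?E (n+3) = {n, n+1, n+2}"
    using out by (auto simp: nbrs_def doubleton_eq_iff)
  have "card (nbrs ?E u) = 3" if "u < n + 4" for u
  proof -
    have "u < n \<or> u = n \<or> u = n+1 \<or> u = n+2 \<or> u = n+3" using that by auto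
    then show ?thesis using old deg new by (elim disjE) simp_all
  qed
  moreover have "e \<subseteq> {..<n+4} \<and> card e = 2" if "e \<in> E" for e
    using G that by (fastforce simp: graph_on_def)
  then have "graph_on {..<n+4} ?E"
    by (auto simp: graph_on_def)
  ultimately show ?thesis by (simp add: regular_graphs_iff)
qed

lemma regular_graphs_K33: "(\<lambda>(i, j). {i, j}) ` ({..<3} \<times> {3..<6}) \<in> regular_graphs 3 6" (is "?E \<in> _")
proof -
  have "nbrs ?E u = (if u < 3 then {3..<6} else {..<3})" if "u < 6" for u
    using that by (auto simp: nbrs_def doubleton_eq_iff image_iff)
  then show ?thesis by (auto simp: regular_graphs_iff graph_on_def)
qed

text \<open>Needed because \<open>pmf_of_set\<close> is meaningful only on a nonempty set. Disjoint
  copies of the complete graph on four vertices are added to the empty graph or to the bipartite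
  graph on \<open>3 + 3\<close> vertices.\<close>

lemma regular_graphs_nonempty:
  assumes "even n" "n \<noteq> 2"
  shows "regular_graphs 3 n \<noteq> {}"
  using assms
proof (induction n rule: less_induct)
  case (less n)
  \<comment> \<open>The value 6 is a separate base case, since subtracting 4 would lead to the
    excluded value 2.\<close>
  consider "n = 0" | "n = 6" | m where "n = m + 4" "even m" "m \<noteq> 2"
  proof -
    have "n = 0 \<or> n = 6 \<or> (n \<ge> 4 \<and> n - 4 \<noteq> 2)" using less.prems by (cases "n < 4") (auto elim!: evenE)
    then show thesis using that(1,2) that(3)[of "n - 4"] less.prems by auto
  qed
  then show ?case
  proof cases
    case 1
    have "{} \<in> regular_graphs 3 0" by (simp add: regular_graphs_def)
    then show ?thesis using 1 by auto
  next
    case 2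
    then show ?thesis using regular_graphs_K33 by auto
  next
    case 3
    then obtain E where "E \<in> regular_graphs 3 m" using less.IH[of m] by auto
    from regular_graphs_add_K4[OF this] show ?thesis using 3 by auto
  qed
qed

section \<open>From few short cycles to the asymptotic statement\<close>

lemma two_independent_nbrs:
  assumes "graph_on V E" "two_independent E V0" "v \<in> V0"
  shows "nbrs E v \<inter> V0 = {}"
proof -
  have False if w: "w \<in> nbrs E v" "w \<in> V0" for w
  proof -
    have "v \<noteq> w" using nbrs_irrefl[OF assms(1)] w(1) by auto
    then have "3 \<le> graph_dist E v w" using assms(2,3) w(2) by (auto simp: two_independent_def)
    also have "graph_dist E v w \<le> enat 1"
      unfolding graph_dist_def
      by (rule Inf_lower) (use w(1) in \<open>auto simp: nbrs_def intro!: exI[of _ 1]\<close>)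
    finally show False by (simp add: numeral_eq_enat)
  qed
  then show ?thesis by blast
qed

text \<open>Markov's inequality for the uniform distribution, written as a count: each graph outside
  the event carries more than \<open>t\<close> short cycles, while the total is at most 324 per
  graph.\<close>

lemma prob_few_short_cycles:
  assumes n: "30 \<le> n" "even n" and t: "t > 0"
  shows "1 - 324 / t \<le> measure_pmf.prob (random_regular_graph 3 n)
    {E \<in> regular_graphs 3 n. real (card (short_cycles E)) \<le> t}"
proof -
  let ?R = "regular_graphs 3 n"
  let ?G = "{E \<in> ?R. real (card (short_cycles E)) \<le> t}" and ?B = "{E \<in> ?R. t < real (card (short_cycles E))}"
  have fin: "finite ?R" by (rule finite_regular_graphs)
  have ne: "?R \<noteq> {}" using n by (intro regular_graphs_nonempty) auto
  then have pos: "card ?R > 0" using fin by (simp add: card_gt_0_iff)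
  have "t * real (card ?B) = (\<Sum>E\<in>?B. t)" by simp
  also have "\<dots> \<le> (\<Sum>E\<in>?B. real (card (short_cycles E)))" by (rule sum_mono) auto
  also have "\<dots> \<le> (\<Sum>E\<in>?R. real (card (short_cycles E)))"
    using fin by (intro sum_mono2) auto
  also have "\<dots> \<le> 324 * real (card ?R)"
    using of_nat_mono[OF sum_card_short_cycles[OF n(1)], where 'a = real] by simp
  finally have "real (card ?B) / real (card ?R) \<le> 324 / t"
    using pos t by (simp add: field_simps)
  moreover have "card ?R = card ?G + card ?B"
    using fin by (subst card_Un_disjoint[symmetric]) (auto intro!: arg_cong[of _ _ card])
  then have "real (card ?R) = real (card ?G) + real (card ?B)" by simp
  then have "real (card ?G) / real (card ?R) = 1 - real (card ?B) / real (card ?R)"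
    using pos by (simp add: eq_diff_eq flip: add_divide_distrib)
  ultimately show ?thesis
    unfolding random_regular_graph_def
    by (simp add: measure_pmf_of_set[OF ne fin] Int_absorb1)
qed

text \<open>The limit runs along even \<open>n\<close>, as a cubic graph has an even number of
  vertices. A single error function bounds the deviation for all admissible \<open>V0\<close> in a
  graph simultaneously.\<close>

theorem proposition32:
  fixes \<alpha> \<beta> \<gamma> :: real
  assumes "\<alpha> > 0"
  shows "\<exists>err :: nat \<Rightarrow> real. err \<in> o(\<lambda>n. real n) \<and>
    ((\<lambda>n. measure_pmf.prob (random_regular_graph 3 n)
        {E. \<forall>V0. V0 \<subseteq> {..<n} \<and> two_independent E V0 \<and> \<alpha> * real n \<le> real (card V0) \<longrightarrow>
          \<bar>expected_improvement {..<n} E \<beta> \<gamma> V0 -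
             3 / 4 * (1 + 2 * sin (2 * \<beta>) * (cos \<gamma>)\<^sup>2 * sin \<gamma>
                        + (sin \<beta>)\<^sup>2 * (cos \<gamma>) ^ 4 * (sin \<gamma>)\<^sup>2) * real (card V0)\<bar> \<le> err n})
      \<longlongrightarrow> 1) (inf at_top (principal {n. even n}))"
proof (intro exI conjI)
  \<comment> \<open>The threshold \<open>sqrt n\<close> for the number of short cycles, times the
    deviation 6 per cycle. It grows slowly enough to be \<open>o(n)\<close>, yet makes the failure
    probability \<open>324 / sqrt n\<close> vanish.\<close>
  let ?err = "\<lambda>n. 6 * sqrt (real n)"
  let ?A = "\<lambda>n. {E. \<forall>V0. V0 \<subseteq> {..<n} \<and> two_independent E V0 \<and> \<alpha> * real n \<le> real (card V0) \<longrightarrow>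
          \<bar>expected_improvement {..<n} E \<beta> \<gamma> V0 -
             3 / 4 * (1 + 2 * sin (2 * \<beta>) * (cos \<gamma>)\<^sup>2 * sin \<gamma>
                        + (sin \<beta>)\<^sup>2 * (cos \<gamma>) ^ 4 * (sin \<gamma>)\<^sup>2) * real (card V0)\<bar> \<le> ?err n}"
  let ?F = "inf at_top (principal {n. even n}) :: nat filter"
  show "?err \<in> o(\<lambda>n. real n)" by real_asymp
  have sub: "{E \<in> regular_graphs 3 n. real (card (short_cycles E)) \<le> sqrt (real n)} \<subseteq> ?A n" for n
  proof (safe, goal_cases)
    case (1 E V0)
    then have G: "graph_on {..<n} E" and deg: "\<And>v. v \<in> {..<n} \<Longrightarrow> card (nbrs E v) = 3"
      by (auto simp: regular_graphs_iff)
    have "\<bar>expected_improvement {..<n} E \<beta> \<gamma> V0 - cubic_rate \<beta> \<gamma> * real (card V0)\<bar> \<le>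
        6 * real (card (short_cycles E))"
      by (rule expected_improvement_approx[OF G deg])
         (use 1 two_independent_nbrs[OF G] in auto)
    then show ?case using 1(2) unfolding cubic_rate_def by linarith
  qed
  have "((\<lambda>n. 1 - 324 / sqrt (real n)) \<longlongrightarrow> 1) at_top" by real_asymp
  then have lower: "((\<lambda>n. 1 - 324 / sqrt (real n)) \<longlongrightarrow> 1) ?F"
    by (rule tendsto_mono[rotated]) simp
  show "((\<lambda>n. measure_pmf.prob (random_regular_graph 3 n) (?A n)) \<longlongrightarrow> 1) ?F"
  proof (rule tendsto_sandwich[OF _ _ lower tendsto_const])
    have "eventually (\<lambda>n. even n \<longrightarrow> 1 - 324 / sqrt (real n) \<le>
        measure_pmf.prob (random_regular_graph 3 n) (?A n)) at_top"
      using eventually_ge_at_top[of 30]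
    proof eventually_elim
      case (elim n)
      show ?case
      proof
        assume "even n"
        have "1 - 324 / sqrt (real n) \<le> measure_pmf.prob (random_regular_graph 3 n)
            {E \<in> regular_graphs 3 n. real (card (short_cycles E)) \<le> sqrt (real n)}"
          using elim \<open>even n\<close> by (intro prob_few_short_cycles) auto
        also have "\<dots> \<le> measure_pmf.prob (random_regular_graph 3 n) (?A n)"
          by (rule measure_pmf.finite_measure_mono[OF sub]) simp
        finally show "1 - 324 / sqrt (real n) \<le> measure_pmf.prob (random_regular_graph 3 n) (?A n)" .
      qed
    qed
    then show "eventually (\<lambda>n. 1 - 324 / sqrt (real n) \<le>
        measure_pmf.prob (random_regular_graph 3 n) (?A n)) ?F"
      by (simp add: eventually_inf_principal)
  qed simp
qed

end
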